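(* For every integer $d\ge 2$ there exists a constant $c>0$ such that for every sufficiently large prime power $q$ and every real number $k \in [4dq^{d-2},\, q^{d-1-\frac{1}{d}}]$, there is a collection $\mathcal{C}=\mathcal{C}(q,k)$ of point sets in $\mathbb{F}^d_q$ satisfying: (i) every general position set of $\mathbb{F}^d_q$ is contained in some member of $\mathcal{C}$; (ii) $|C|\le kq$ for all $C\in \mathcal{C}$; and (iii) $|\mathcal{C}|\le 2^{\,c k^{-1}q^{d-1}(\log q)^2}$.
   Context: $\mathbb{F}_q$ is the finite field with $q$ elements. A hyperplane in $\mathbb{F}_q^d$ is a $(d-1)$-dimensional affine subspace; a point set is in general position if no $d+1$ of its points lie in a common hyperplane. $\log$ is in base $2$. *)

theory Defs
  imports
    "HOL-Number_Theory.Prime_Powers"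
    "HOL-Algebra.Weak_Morphisms"
    "Jordan_Normal_Form.Missing_VectorSpace"
begin

text \<open>
  A field \<open>F\<close> is a HOL-Algebra record. The constant of the theorem has to be uniform in
  all finite fields, so these must range over one HOL type: \<open>nat ring\<close> is used,
  with arbitrary carriers and operations, and the following lemma shows that this
  covers all finite fields up to isomorphism.
\<close>

lemma finite_field_iso_nat_ring:
  fixes R :: "'a ring"
  assumes "Ring.field R" and "finite (carrier R)"
  shows "\<exists>F :: nat ring. Ring.field F \<and> order F = order R \<and> ring_iso R F \<noteq> {}"
proof -
  obtain f :: "'a \<Rightarrow> nat" where f: "inj_on f (carrier R)"
    using assms(2) finite_imp_inj_to_nat_seg by blast
  interpret field R by fact
  have "Ring.field (image_ring f R)"
    using f inj_imp_image_ring_is_field by blast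
  moreover have "f \<in> ring_iso R (image_ring f R)"
    using f inj_imp_image_ring_iso by blast
  moreover have "order (image_ring f R) = order R"
    using f by (simp add: order_def image_ring_carrier card_image)
  ultimately show ?thesis by blast
qed

text \<open>
  The space \<open>F^d\<close>: coordinate functions \<open>{..<d} \<rightarrow>\<^sub>E carrier F\<close> (extensional, so that equality
  of points is equality of coordinates) with pointwise operations.
\<close>

definition affine_space ::
    "('a, 'm) ring_scheme \<Rightarrow> nat \<Rightarrow> ('a, nat \<Rightarrow> 'a) module" where
  "affine_space F d = ring.func_space F {..<d}"

definition affine_subspace ::
    "('a, 'm) ring_scheme \<Rightarrow> nat \<Rightarrow> nat \<Rightarrow> (nat \<Rightarrow> 'a) set \<Rightarrow> bool" where
  "affine_subspace F d m H \<longleftrightarrow>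
     (\<exists>v W. v \<in> carrier (affine_space F d)
          \<and> VectorSpace.subspace F W (affine_space F d)
          \<and> vectorspace.dim F ((affine_space F d)\<lparr>carrier := W\<rparr>) = m
          \<and> H = v <+\<^bsub>affine_space F d\<^esub> W)"

definition hyperplane ::
    "('a, 'm) ring_scheme \<Rightarrow> nat \<Rightarrow> (nat \<Rightarrow> 'a) set \<Rightarrow> bool" where
  "hyperplane F d H \<longleftrightarrow> affine_subspace F d (d - 1) H"

definition general_position ::
    "('a, 'm) ring_scheme \<Rightarrow> nat \<Rightarrow> (nat \<Rightarrow> 'a) set \<Rightarrow> bool" where
  "general_position F d S \<longleftrightarrow>
     S \<subseteq> carrier (affine_space F d)
     \<and> \<not> (\<exists>T \<subseteq> S. card T = d + 1 \<and> (\<exists>H. hyperplane F d H \<and> T \<subseteq> H))"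

end

theory Submission
  imports Defs "HOL-Analysis.Convex"
begin

text \<open>
  The containers come from the Kleitman--Winston algorithm, run on a graph that depends on a small
  part of the set. Fix \<open>s \<approx> q\<^bsup>1/d\<^esup>\<close> points \<open>T\<close> of a set \<open>S\<close> in general position and about
  \<open>k / q\<^bsup>d-2\<^esup>\<close> of the \<open>(d-1)\<close>-subsets \<open>P\<close> of \<open>T\<close>, and join two points \<open>x, y\<close> if some \<open>P \<union> {x, y}\<close> lies in
  a hyperplane; then \<open>S - T\<close> is independent. For each \<open>P\<close> the \<open>q + 1\<close> hyperplanes of a pencil through
  \<open>P\<close> cover the space, so for an average \<open>x \<in> U\<close> the hyperplane of the pencil through \<open>x\<close> contains
  at least \<open>|U| / (q + 1)\<close> points of \<open>U\<close>. A hyperplane contains at most \<open>d\<close> points of \<open>T\<close>, hence arises from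
  boundedly many \<open>P\<close>, and two distinct hyperplanes share at most \<open>q\<^bsup>d-2\<^esup>\<close> points. As long as
  \<open>|U| > kq/2\<close>, the overlaps are negligible, and some vertex has degree at least a constant times
  \<open>k |U| / q\<^bsup>d-1\<^esup>\<close> in \<open>U\<close>. The algorithm therefore stops after \<open>O(k\<^bsup>-1\<^esup> q\<^bsup>d-1\<^esup> log q)\<close> choices.
\<close>

section \<open>Counting\<close>

text \<open>Cauchy-Schwarz for the fibre sizes: the sum on the right counts pairs with equal image,
  which is the sum of the squared fibre sizes. It is used with \<open>\<phi>\<close> sending a point
  to its hyperplane in a pencil.\<close>

lemma card_squared_le_sum_fibres:
  assumes "finite U" "finite K" "\<phi> ` U \<subseteq> K"
  shows "(card U)\<^sup>2 \<le> card K * (\<Sum>x\<in>U. card {y\<in>U. \<phi> y = \<phi> x})"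
proof -
  define n where "n c = card {y\<in>U. \<phi> y = c}" for c
  have U: "card U = (\<Sum>c\<in>K. n c)"
    unfolding n_def using sum.group[OF assms, of "\<lambda>_. 1::nat"] by simp
  have "(\<Sum>x\<in>U. n (\<phi> x)) = (\<Sum>c\<in>K. \<Sum>x | x \<in> U \<and> \<phi> x = c. n (\<phi> x))"
    using sum.group[OF assms, of "\<lambda>x. n (\<phi> x)"] by simp
  also have "\<dots> = (\<Sum>c\<in>K. (n c)\<^sup>2)"
    by (intro sum.cong) (auto simp: n_def power2_eq_square)
  finally have S: "(\<Sum>x\<in>U. n (\<phi> x)) = (\<Sum>c\<in>K. (n c)\<^sup>2)" .
  have "(\<Sum>c\<in>K. real (n c))\<^sup>2 \<le> real (card K) * (\<Sum>c\<in>K. (real (n c))\<^sup>2)"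
    using sum_squared_le_sum_of_squares[of "\<lambda>c. real (n c)" K] by (simp add: mult.commute)
  then have "real ((\<Sum>c\<in>K. n c)\<^sup>2) \<le> real (card K * (\<Sum>c\<in>K. (n c)\<^sup>2))"
    by simp
  then show ?thesis
    using S U unfolding n_def of_nat_le_iff by simp
qed

text \<open>A truncated inclusion-exclusion. Sets are added one at a time, each meeting the union of
  the earlier ones in at most \<open>card I * r\<close> elements. Charging ordered pairs of indices
  loses a factor 2 and avoids a division.\<close>

lemma sum_card_le_card_UN:
  assumes "finite I" "\<And>i. i \<in> I \<Longrightarrow> finite (A i)"
    and "\<And>i j. i \<in> I \<Longrightarrow> j \<in> I \<Longrightarrow> i \<noteq> j \<Longrightarrow> card (A i \<inter> A j) \<le> r"
  shows "(\<Sum>i\<in>I. card (A i)) \<le> card (\<Union>i\<in>I. A i) + card I * (card I - 1) * r"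
  using assms
proof (induction I rule: finite_induct)
  case empty
  then show ?case by simp
next
  case (insert i I)
  let ?U = "\<Union>j\<in>I. A j"
  have "A i \<inter> ?U = (\<Union>j\<in>I. A i \<inter> A j)" by auto
  then have "card (A i \<inter> ?U) \<le> (\<Sum>j\<in>I. card (A i \<inter> A j))"
    using card_UN_le[OF insert.hyps(1), of "\<lambda>j. A i \<inter> A j"] by simp
  also have "\<dots> \<le> (\<Sum>j\<in>I. r)"
    using insert.hyps insert.prems by (intro sum_mono) auto
  finally have "card (A i \<inter> ?U) \<le> card I * r" by simp
  moreover have "card (A i) + card ?U = card (A i \<union> ?U) + card (A i \<inter> ?U)"
    using insert.hyps insert.prems by (intro card_Un_Int) auto
  moreover have "(\<Sum>j\<in>I. card (A j)) \<le> card ?U + card I * (card I - 1) * r"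
    using insert.prems by (intro insert.IH) auto
  moreover have "card I * r + card I * (card I - 1) * r \<le> Suc (card I) * card I * r"
    unfolding add_mult_distrib[symmetric] by (rule mult_le_mono1, cases "card I") auto
  ultimately show ?case
    using insert.hyps by simp
qed

text \<open>Each of \<open>s\<close> slots holds an element of \<open>V\<close> or stays empty. This
  crude count pays for the choice of the set \<open>T\<close>.\<close>

lemma card_bounded_subsets_le:
  assumes "finite V"
  shows "card {A. A \<subseteq> V \<and> card A \<le> s} \<le> (card V + 1) ^ s"
proof (induction s)
  case 0
  have "{A. A \<subseteq> V \<and> card A \<le> 0} = {{}}"
    using assms by (auto dest: finite_subset)
  then show ?case by simp
next
  case (Suc s)
  let ?A = "\<lambda>s. {A. A \<subseteq> V \<and> card A \<le> s}"
  have fin: "finite (?A s)" for s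
    using assms by (auto intro: finite_subset[of _ "Pow V"])
  have "?A (Suc s) \<subseteq> ?A s \<union> (\<lambda>(x, A). insert x A) ` (V \<times> ?A s)"
  proof
    fix A assume A: "A \<in> ?A (Suc s)"
    show "A \<in> ?A s \<union> (\<lambda>(x, A). insert x A) ` (V \<times> ?A s)"
    proof (cases "A = {}")
      case False
      then obtain x where "x \<in> A" by auto
      moreover have "finite A" using A assms finite_subset by auto
      ultimately have "(x, A - {x}) \<in> V \<times> ?A s" "A = insert x (A - {x})" using A by auto
      then show ?thesis by (intro UnI2 image_eqI[where x="(x, A - {x})"]) auto
    qed auto
  qed
  then have "card (?A (Suc s)) \<le> card (?A s \<union> (\<lambda>(x, A). insert x A) ` (V \<times> ?A s))"
    using assms fin by (intro card_mono) auto
  also have "\<dots> \<le> card (?A s) + card ((\<lambda>(x, A). insert x A) ` (V \<times> ?A s))"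
    by (rule card_Un_le)
  also have "\<dots> \<le> card (?A s) + card (V \<times> ?A s)"
    using assms fin by (intro add_left_mono card_image_le) auto
  also have "\<dots> = (card V + 1) * card (?A s)"
    by (simp add: card_cartesian_product)
  also have "\<dots> \<le> (card V + 1) ^ Suc s"
    using mult_le_mono2[OF Suc.IH, of "card V + 1"] by (simp only: power_Suc)
  finally show ?case .
qed

text \<open>
  Branching on a vertex \<open>x\<close> of large degree, an independent set either avoids \<open>x\<close> or avoids all
  neighbours of \<open>x\<close>; the second case can occur at most \<open>j\<close> times. Since the vertices chosen there belong
  to \<open>I\<close>, they contribute at most \<open>card I\<close> to the size of the container.
\<close>

lemma independent_set_containers:
  fixes R :: "'a \<Rightarrow> 'a \<Rightarrow> bool" and \<beta> B :: real
  assumes "finite V" "\<beta> \<le> 1"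
    and deg: "\<And>U. U \<subseteq> V \<Longrightarrow> B < card U \<Longrightarrow> \<exists>x\<in>U. \<beta> * card U \<le> card {y\<in>U. R x y}"
    and "U \<subseteq> V" "card U * (1 - \<beta>) ^ j \<le> B"
  shows "\<exists>\<C>. finite \<C> \<and> card \<C> \<le> (card U + 1) ^ j \<and> (\<forall>C\<in>\<C>. C \<subseteq> U) \<and>
    (\<forall>I \<subseteq> U. (\<forall>x\<in>I. \<forall>y\<in>I. x \<noteq> y \<longrightarrow> \<not> R x y) \<longrightarrow> (\<exists>C\<in>\<C>. I \<subseteq> C \<and> card C \<le> B + card I))"
    (is "\<exists>\<C>. ?P U j \<C>")
  using assms(4,5)
proof (induction "card U" arbitrary: U j rule: less_induct)
  case less
  define indep where "indep I \<longleftrightarrow> (\<forall>x\<in>I. \<forall>y\<in>I. x \<noteq> y \<longrightarrow> \<not> R x y)" for I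
  have finU: "finite U" using less.prems(1) assms(1) finite_subset by blast
  show ?case
  proof (cases "card U \<le> B")
    case True
    then have "?P U j {U}" by auto
    then show ?thesis by blast
  next
    case False
    with deg[OF less.prems(1)] obtain x where x: "x \<in> U" "\<beta> * card U \<le> card {y\<in>U. R x y}"
      by auto
    \<comment> \<open>With \<open>j = 0\<close> the hypothesis would give
      \<open>card U \<le> B\<close>, so a large \<open>U\<close> always leaves a step to
      spend.\<close>
    obtain i where j: "j = Suc i"
      using False less.prems(2) by (cases j) auto
    \<comment> \<open>\<open>U1\<close> serves the sets avoiding \<open>x\<close> and keeps the
      budget \<open>j\<close>. \<open>U2\<close> serves the sets containing \<open>x\<close>; it
      spends one step, paid for by losing at least a fraction \<open>\<beta>\<close> of
      \<open>U\<close>.\<close>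
    define U1 where "U1 = U - {x}"
    define U2 where "U2 = U1 - {y\<in>U. R x y}"
    have c1: "Suc (card U1) = card U" unfolding U1_def using x finU
      by (metis card_Suc_Diff1)
    have sub: "U1 \<subseteq> U" "U2 \<subseteq> U" "U2 \<subseteq> U1" by (auto simp: U1_def U2_def)
    have fin1: "finite U1" using finU by (simp add: U1_def)
    have c21: "card U2 \<le> card U1" using sub fin1 card_mono by blast
    have "card U2 \<le> card (U - {y\<in>U. R x y})"
      using finU by (intro card_mono) (auto simp: U1_def U2_def)
    also have "\<dots> = card U - card {y\<in>U. R x y}"
      using finU by (intro card_Diff_subset) auto
    also have "real \<dots> = real (card U) - card {y\<in>U. R x y}"
      using finU by (intro of_nat_diff card_mono) auto
    finally have c2: "card U2 \<le> (1 - \<beta>) * card U" using x(2) by (simp add: algebra_simps)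
    have "card U1 * (1 - \<beta>) ^ j \<le> card U * (1 - \<beta>) ^ j"
      using c1 \<open>\<beta> \<le> 1\<close> by (intro mult_right_mono) auto
    then have "card U1 * (1 - \<beta>) ^ j \<le> B" using less.prems(2) by simp
    moreover have "card U1 < card U" "U1 \<subseteq> V" "U2 \<subseteq> V"
      using c1 sub less.prems(1) by auto
    ultimately have "\<exists>\<C>. ?P U1 j \<C>" by (intro less.hyps)
    then obtain \<C>1 where C1: "finite \<C>1" "card \<C>1 \<le> (card U1 + 1) ^ j" "\<And>C. C \<in> \<C>1 \<Longrightarrow> C \<subseteq> U1"
      "\<And>I. I \<subseteq> U1 \<Longrightarrow> indep I \<Longrightarrow> \<exists>C\<in>\<C>1. I \<subseteq> C \<and> card C \<le> B + card I"
      unfolding indep_def[symmetric] by (elim exE conjE) simp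
    have "card U2 * (1 - \<beta>) ^ i \<le> (1 - \<beta>) * card U * (1 - \<beta>) ^ i"
      using c2 \<open>\<beta> \<le> 1\<close> by (intro mult_right_mono) auto
    also have "\<dots> = card U * (1 - \<beta>) ^ j" by (simp add: j)
    finally have "card U2 * (1 - \<beta>) ^ i \<le> B" using less.prems(2) by simp
    moreover have "card U2 < card U" using c1 c21 by simp
    ultimately have "\<exists>\<C>. ?P U2 i \<C>" using \<open>U2 \<subseteq> V\<close> by (intro less.hyps)
    then obtain \<C>2 where C2: "finite \<C>2" "card \<C>2 \<le> (card U2 + 1) ^ i" "\<And>C. C \<in> \<C>2 \<Longrightarrow> C \<subseteq> U2"
      "\<And>I. I \<subseteq> U2 \<Longrightarrow> indep I \<Longrightarrow> \<exists>C\<in>\<C>2. I \<subseteq> C \<and> card C \<le> B + card I"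
      unfolding indep_def[symmetric] by (elim exE conjE) simp
    let ?C = "\<C>1 \<union> insert x ` \<C>2"
    have "finite ?C" using C1 C2 by simp
    moreover have "card ?C \<le> (card U + 1) ^ j"
    proof -
      have "card ?C \<le> card \<C>1 + card (insert x ` \<C>2)" by (rule card_Un_le)
      also have "\<dots> \<le> card \<C>1 + card \<C>2" using C2(1) by (simp add: card_image_le)
      also have "\<dots> \<le> (card U1 + 1) ^ j + (card U2 + 1) ^ i" by (intro add_mono C1 C2)
      \<comment> \<open>Since \<open>card U1 + 1 = card U\<close>, the two branches contribute at
        most \<open>n ^ j + n ^ i = (n + 1) * n ^ i\<close> with \<open>n = card U\<close>, which is
        within \<open>(n + 1) ^ j\<close>.\<close>
      also have "\<dots> \<le> card U ^ j + card U ^ i"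
        using c1 c21 by (intro add_mono power_mono) auto
      also have "\<dots> = (card U + 1) * card U ^ i" by (simp add: j)
      also have "\<dots> \<le> (card U + 1) * (card U + 1) ^ i" by (intro mult_le_mono2 power_mono) auto
      finally show ?thesis by (simp add: j)
    qed
    moreover have "C \<subseteq> U" if "C \<in> ?C" for C
      using that C1(3) C2(3) sub x(1) by fastforce
    moreover have "\<exists>C\<in>?C. I \<subseteq> C \<and> card C \<le> B + card I" if I: "I \<subseteq> U" "indep I" for I
    proof (cases "x \<in> I")
      case False
      then have "I \<subseteq> U1" using I(1) by (auto simp: U1_def)
      from C1(4)[OF this I(2)] show ?thesis by auto
    next
      case True
      have "I - {x} \<subseteq> U2" "indep (I - {x})" using I True by (auto simp: U1_def U2_def indep_def)
      from C2(4)[OF this] obtain C where C: "C \<in> \<C>2" "I - {x} \<subseteq> C" "card C \<le> B + card (I - {x})"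
        by auto
      have "finite I" using I(1) finU finite_subset by auto
      then have "Suc (card (I - {x})) = card I" using True by (metis card_Suc_Diff1)
      moreover have "card (insert x C) \<le> Suc (card C)" by (rule card_insert_le_m1) auto
      ultimately have "card (insert x C) \<le> B + card I" using C(3) by linarith
      then show ?thesis using C by (intro bexI[of _ "insert x C"]) auto
    qed
    ultimately show ?thesis
      unfolding indep_def[symmetric] by (intro exI[of _ ?C]) simp
  qed
qed

section \<open>Affine forms over a finite field\<close>

text \<open>A finite basis gives every vector unique coordinates. The formula is used backwards, to
  read off the dimension of a subspace from its size.\<close>

lemma (in vectorspace) card_carrier_eq_power_dim:
  assumes "finite (carrier K)" "finite (carrier V)"
  shows "card (carrier V) = card (carrier K) ^ dim"
proof -
  have "gen_set (carrier V)"
    using span_is_subset2[of "carrier V"] in_own_span[of "carrier V"] by auto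
  then have "fin_dim" unfolding fin_dim_def using assms(2) by blast
  then obtain A where A: "finite A" "basis A"
    using finite_basis_exists by auto
  have AV: "A \<subseteq> carrier V" using A(2) by (simp add: basis_def)
  then have ex: "\<exists>!a. a \<in> A \<rightarrow>\<^sub>E carrier K \<and> lincomb a A = v" if "v \<in> carrier V" for v
    using basis_criterion[OF A(1)] A(2) that by blast
  have closed: "lincomb a A \<in> carrier V" if "a \<in> A \<rightarrow>\<^sub>E carrier K" for a
    using AV that by (intro lincomb_closed) auto
  have "bij_betw (\<lambda>a. lincomb a A) (A \<rightarrow>\<^sub>E carrier K) (carrier V)"
  proof (rule bij_betwI')
    fix a b assume ab: "a \<in> A \<rightarrow>\<^sub>E carrier K" "b \<in> A \<rightarrow>\<^sub>E carrier K"
    show "(lincomb a A = lincomb b A) = (a = b)"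
      using ex[OF closed[OF ab(1)]] ab by metis
  next
    fix v assume "v \<in> carrier V"
    then show "\<exists>a\<in>A \<rightarrow>\<^sub>E carrier K. v = lincomb a A" using ex by metis
  qed (rule closed)
  then have "card (carrier V) = card (A \<rightarrow>\<^sub>E carrier K)"
    by (simp add: bij_betw_same_card)
  also have "\<dots> = card (carrier K) ^ dim"
    using A dim_basis[of A] by (simp add: card_PiE)
  finally show ?thesis .
qed

locale finite_field = field F for F (structure) +
  assumes finite_carrier: "finite (carrier F)"
begin

abbreviation q :: nat where "q \<equiv> card (carrier F)"

abbreviation points :: "nat \<Rightarrow> (nat \<Rightarrow> 'a) set" where
  "points d \<equiv> {..<d} \<rightarrow>\<^sub>E carrier F"

abbreviation affine_forms :: "nat \<Rightarrow> (nat \<Rightarrow> 'a) set" where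
  "affine_forms d \<equiv> {..d} \<rightarrow>\<^sub>E carrier F"

text \<open>
  A form \<open>f\<close> stands for the polynomial \<open>f d + f 0 x\<^sub>0 + \<dots> + f (d - 1) x\<^bsub>d-1\<^esub>\<close>: its constant term is
  the coefficient with index \<open>d\<close>.
\<close>

definition aff :: "nat \<Rightarrow> (nat \<Rightarrow> 'a) \<Rightarrow> (nat \<Rightarrow> 'a) \<Rightarrow> 'a" where
  "aff d f x = f d \<oplus> (\<Oplus>i\<in>{..<d}. f i \<otimes> x i)"

definition zeros :: "nat \<Rightarrow> (nat \<Rightarrow> 'a) \<Rightarrow> (nat \<Rightarrow> 'a) set" where
  "zeros d f = {x \<in> points d. aff d f x = \<zero>}"

text \<open>These are the forms whose zero sets are hyperplanes; a constant form vanishes everywhere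
  or nowhere.\<close>

definition nonconst_forms :: "nat \<Rightarrow> (nat \<Rightarrow> 'a) set" where
  "nonconst_forms d = {f \<in> affine_forms d. \<exists>i<d. f i \<noteq> \<zero>}"

text \<open>Up to scaling, these are the members of the pencil of \<open>f\<close> and
  \<open>g\<close> other than \<open>g\<close> itself. The restriction keeps the result extensional,
  so that equal coefficients mean equal forms.\<close>

definition sub_form :: "nat \<Rightarrow> (nat \<Rightarrow> 'a) \<Rightarrow> 'a \<Rightarrow> (nat \<Rightarrow> 'a) \<Rightarrow> nat \<Rightarrow> 'a" where
  "sub_form d f c g = (\<lambda>i\<in>{..d}. f i \<ominus> c \<otimes> g i)"

section \<open>Points, forms and evaluation\<close>

lemma carrier_affine_space: "carrier (affine_space F d) = points d"
  by (simp add: affine_space_def func_space_def)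

lemma one_less_q: "1 < q"
proof -
  have "card {\<zero>, \<one>} \<le> q" using finite_carrier by (intro card_mono) auto
  then show ?thesis by simp
qed

lemma finite_points: "finite (points d)" and card_points: "card (points d) = q ^ d"
  using finite_carrier by (auto simp: card_PiE intro: finite_PiE)

lemma zeros_subset_points: "zeros d f \<subseteq> points d"
  by (auto simp: zeros_def)

lemma finite_zeros: "finite (zeros d f)"
  by (rule finite_subset[OF zeros_subset_points finite_points])

lemma nonconst_formsD: "f \<in> nonconst_forms d \<Longrightarrow> f \<in> affine_forms d"
  by (simp add: nonconst_forms_def)

lemma coeff_closed: "f \<in> affine_forms d \<Longrightarrow> i \<le> d \<Longrightarrow> f i \<in> carrier F"
  using PiE_mem[of f "{..d}" "\<lambda>_. carrier F" i] by simp

lemma coord_closed: "x \<in> points d \<Longrightarrow> i < d \<Longrightarrow> x i \<in> carrier F"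
  using PiE_mem[of x "{..<d}" "\<lambda>_. carrier F" i] by simp

lemma aff_closed [simp]: "f \<in> affine_forms d \<Longrightarrow> x \<in> points d \<Longrightarrow> aff d f x \<in> carrier F"
  unfolding aff_def by (intro a_closed finsum_closed) (auto simp: coeff_closed coord_closed)

lemma sub_form_closed [simp]:
  "f \<in> affine_forms d \<Longrightarrow> g \<in> affine_forms d \<Longrightarrow> c \<in> carrier F \<Longrightarrow> sub_form d f c g \<in> affine_forms d"
  unfolding sub_form_def by (auto simp: coeff_closed)

lemma aff_sub_form:
  assumes "f \<in> affine_forms d" "g \<in> affine_forms d" "c \<in> carrier F" "x \<in> points d"
  shows "aff d (sub_form d f c g) x = aff d f x \<ominus> c \<otimes> aff d g x"
proof -
  have fg: "f i \<in> carrier F" "g i \<in> carrier F" if "i \<le> d" for i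
    using assms that coeff_closed coord_closed by auto
  have x: "x i \<in> carrier F" if "i < d" for i
    using assms that coeff_closed coord_closed by auto
  define A where "A = (\<Oplus>i\<in>{..<d}. f i \<otimes> x i)"
  define B where "B = (\<Oplus>i\<in>{..<d}. g i \<otimes> x i)"
  have AB: "A \<in> carrier F" "B \<in> carrier F"
    unfolding A_def B_def using fg x by (auto intro!: finsum_closed)
  have "(\<Oplus>i\<in>{..<d}. sub_form d f c g i \<otimes> x i) = (\<Oplus>i\<in>{..<d}. f i \<otimes> x i \<oplus> (\<ominus> c) \<otimes> (g i \<otimes> x i))"
    using fg x assms(3)
    by (intro finsum_cong') (auto simp: sub_form_def a_minus_def l_distr m_assoc l_minus)
  also have "\<dots> = A \<oplus> (\<Oplus>i\<in>{..<d}. (\<ominus> c) \<otimes> (g i \<otimes> x i))"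
    unfolding A_def using fg x assms(3) by (intro finsum_addf) auto
  also have "(\<Oplus>i\<in>{..<d}. (\<ominus> c) \<otimes> (g i \<otimes> x i)) = (\<ominus> c) \<otimes> B"
    unfolding B_def using fg x assms(3) by (intro finsum_rdistr[symmetric]) auto
  finally have "aff d (sub_form d f c g) x = (f d \<ominus> c \<otimes> g d) \<oplus> (A \<oplus> (\<ominus> c) \<otimes> B)"
    unfolding aff_def by (simp add: sub_form_def)
  also have "\<dots> = (f d \<oplus> A) \<ominus> c \<otimes> (g d \<oplus> B)"
    using fg[of d] AB assms(3)
    by (simp add: a_minus_def r_distr l_minus minus_add a_ac)
  finally show ?thesis unfolding aff_def A_def B_def .
qed

section \<open>Numbers of zeros of one form and of two forms\<close>

text \<open>All terms but the one with index \<open>i\<close> cancel, and \<open>f i\<close> is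
  invertible. Products rather than coordinates are compared, so that \<open>x\<close> and
  \<open>y\<close> may also differ where the coefficient of \<open>f\<close> is zero; the
  elimination in \<open>card_zeros_Int\<close> relies on this.\<close>

lemma aff_cancel:
  assumes "f \<in> affine_forms d" "x \<in> points d" "y \<in> points d" "i < d" "f i \<noteq> \<zero>"
    and "\<And>l. l < d \<Longrightarrow> l \<noteq> i \<Longrightarrow> f l \<otimes> x l = f l \<otimes> y l"
    and "aff d f x = aff d f y"
  shows "x i = y i"
proof -
  have f: "f i \<in> carrier F" if "i \<le> d" for i
    using assms that coeff_closed coord_closed by auto
  have xy: "x i \<in> carrier F" "y i \<in> carrier F" if "i < d" for i
    using assms(2,3) that coord_closed by auto
  define r where "r z = f d \<oplus> (\<Oplus>l\<in>{..<d} - {i}. f l \<otimes> z l)" for z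
  have rc: "r x \<in> carrier F" "r y \<in> carrier F"
    unfolding r_def using f xy by (auto intro!: a_closed finsum_closed)
  have split: "aff d f z = f i \<otimes> z i \<oplus> r z" if "z \<in> points d" for z
  proof -
    have z: "z i \<in> carrier F" if "i < d" for i
      using \<open>z \<in> points d\<close> that coord_closed by auto
    have "{..<d} = insert i ({..<d} - {i})" using assms(4) by auto
    then have "(\<Oplus>l\<in>{..<d}. f l \<otimes> z l) = (\<Oplus>l\<in>insert i ({..<d} - {i}). f l \<otimes> z l)" by simp
    also have "\<dots> = f i \<otimes> z i \<oplus> (\<Oplus>l\<in>{..<d} - {i}. f l \<otimes> z l)"
      using f z assms(4) by (intro finsum_insert) auto
    finally show ?thesis
      unfolding aff_def r_def using f z assms(4)
      by (subst a_lcomm[symmetric]) (auto intro!: finsum_closed)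
  qed
  have "r x = r y"
    unfolding r_def using assms(6) f xy by (intro arg_cong[of _ _ "(\<oplus>) (f d)"] finsum_cong') auto
  then have "f i \<otimes> x i \<oplus> r x = f i \<otimes> y i \<oplus> r x"
    using split assms by metis
  then have "f i \<otimes> x i = f i \<otimes> y i"
    using rc f[of i] xy[of i] assms(4) by simp
  then show ?thesis
    using m_lcancel[of "f i" "x i" "y i"] assms(4,5) f[of i] xy[of i] by auto
qed

text \<open>Dropping a coordinate with nonzero coefficient is injective on every level set, so each
  has at most \<open>q ^ (d - 1)\<close> points. The \<open>q\<close> level sets partition
  \<open>q ^ d\<close> points, hence none can be smaller.\<close>

lemma card_level_set:
  assumes f: "f \<in> nonconst_forms d" and c: "c \<in> carrier F"
  shows "card {x \<in> points d. aff d f x = c} = q ^ (d - 1)"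
proof -
  define Z where "Z c = {x \<in> points d. aff d f x = c}" for c
  obtain i where i: "i < d" "f i \<noteq> \<zero>" and fa: "f \<in> affine_forms d"
    using f by (auto simp: nonconst_forms_def)
  have finZ: "finite (Z c)" for c unfolding Z_def using finite_points by auto
  have le: "card (Z c) \<le> q ^ (d - 1)" for c
  proof -
    have "inj_on (\<lambda>x. restrict x ({..<d} - {i})) (Z c)"
    proof (rule inj_onI)
      fix x y assume xy: "x \<in> Z c" "y \<in> Z c"
        and e: "restrict x ({..<d} - {i}) = restrict y ({..<d} - {i})"
      have l: "x l = y l" if "l < d" "l \<noteq> i" for l
        using fun_cong[OF e, of l] that by simp
      have "x i = y i"
        using xy l i fa by (intro aff_cancel[of f d x y i]) (auto simp: Z_def)
      then show "x = y"
        using xy l unfolding Z_def by (intro PiE_ext[of x "{..<d}" "\<lambda>_. carrier F"]) auto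
    qed
    moreover have "(\<lambda>x. restrict x ({..<d} - {i})) ` Z c \<subseteq> ({..<d} - {i}) \<rightarrow>\<^sub>E carrier F"
      by (intro image_subsetI restrict_PiE_iff[THEN iffD2] ballI, rule coord_closed[of _ d])
        (simp_all add: Z_def)
    moreover have "finite (({..<d} - {i}) \<rightarrow>\<^sub>E carrier F)"
      using finite_carrier by (intro finite_PiE) auto
    ultimately have "card (Z c) \<le> card (({..<d} - {i}) \<rightarrow>\<^sub>E carrier F)"
      by (rule card_inj_on_le)
    also have "\<dots> = q ^ (d - 1)" using i by (simp add: card_PiE)
    finally show ?thesis .
  qed
  have "points d = (\<Union>c\<in>carrier F. Z c)"
  proof (intro equalityI subsetI)
    fix x assume "x \<in> points d"
    then show "x \<in> (\<Union>c\<in>carrier F. Z c)" using aff_closed[OF fa, of x] by (simp add: Z_def)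
  qed (simp add: Z_def)
  moreover have "card (\<Union>c\<in>carrier F. Z c) = (\<Sum>c\<in>carrier F. card (Z c))"
    using finite_carrier finZ by (intro card_UN_disjoint) (auto simp: Z_def)
  ultimately have tot: "(\<Sum>c\<in>carrier F. card (Z c)) = q ^ d"
    using card_points[of d] by simp
  have "card (Z c) = q ^ (d - 1)"
  proof (rule ccontr)
    assume "card (Z c) \<noteq> q ^ (d - 1)"
    then have "(\<Sum>c\<in>carrier F. card (Z c)) < (\<Sum>c\<in>carrier F. q ^ (d - 1))"
      using le c finite_carrier by (intro sum_strict_mono_ex1) (auto simp: order_less_le)
    also have "\<dots> = q ^ d" using i by (cases d) auto
    finally show False using tot by simp
  qed
  then show ?thesis unfolding Z_def .
qed

lemma card_zeros: "f \<in> nonconst_forms d \<Longrightarrow> card (zeros d f) = q ^ (d - 1)"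
  unfolding zeros_def by (rule card_level_set) auto

lemma sub_form_eq_zeroD:
  assumes "f \<in> affine_forms d" "g \<in> affine_forms d" "c \<in> carrier F"
    and "\<And>i. i \<le> d \<Longrightarrow> sub_form d f c g i = \<zero>" "i \<le> d"
  shows "f i = c \<otimes> g i"
proof -
  have "f i \<in> carrier F" "g i \<in> carrier F" using assms coeff_closed by auto
  moreover have "f i \<ominus> c \<otimes> g i = \<zero>" using assms(4)[OF assms(5)] assms(5) by (simp add: sub_form_def)
  ultimately show ?thesis using assms(3) by (simp)
qed

lemma aff_const:
  assumes "f \<in> affine_forms d" "x \<in> points d" "\<And>i. i < d \<Longrightarrow> f i = \<zero>"
  shows "aff d f x = f d"
proof -
  have x: "x i \<in> carrier F" if "i < d" for i
    using assms(2) that coord_closed by auto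
  have "(\<Oplus>i\<in>{..<d}. f i \<otimes> x i) = (\<Oplus>i\<in>{..<d}. \<zero>)"
    using assms(3) x by (intro finsum_cong') auto
  then show ?thesis
    using coeff_closed[OF assms(1), of d] unfolding aff_def by simp
qed

text \<open>A constant form with a zero is the zero form.\<close>

lemma nonconst_formI:
  assumes "f \<in> affine_forms d" "x \<in> zeros d f" "i \<le> d" "f i \<noteq> \<zero>"
  shows "f \<in> nonconst_forms d"
proof (rule ccontr)
  assume "f \<notin> nonconst_forms d"
  then have z: "f i = \<zero>" if "i < d" for i using assms(1) that by (auto simp: nonconst_forms_def)
  then have "f d = \<zero>"
    using aff_const[OF assms(1), of x] assms(2) by (auto simp: zeros_def)
  then show False using z assms(3,4) by (metis le_neq_implies_less)
qed

text \<open>Elimination: \<open>h = g - c f\<close> has no variable \<open>i\<close>. If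
  \<open>h\<close> were zero, \<open>f\<close> and \<open>g\<close> would be proportional and have
  the same zeros; if it were a nonzero constant, the hyperplanes would be parallel, against the
  common point \<open>z\<close>. So \<open>h\<close> involves another variable \<open>j\<close>, and
  the two equations determine both coordinates from the others.\<close>

lemma card_zeros_Int:
  assumes f: "f \<in> nonconst_forms d" and g: "g \<in> nonconst_forms d"
    and ne: "zeros d f \<noteq> zeros d g" and z: "z \<in> zeros d f" "z \<in> zeros d g"
  shows "card (zeros d f \<inter> zeros d g) \<le> q ^ (d - 2)"
proof -
  obtain i where i: "i < d" "f i \<noteq> \<zero>" and fa: "f \<in> affine_forms d"
    using f by (auto simp: nonconst_forms_def)
  have ga: "g \<in> affine_forms d" using g by (rule nonconst_formsD)
  have fi: "f i \<in> carrier F" "g i \<in> carrier F" using fa ga i coeff_closed by auto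
  define c where "c = g i \<otimes> inv (f i)"
  have inv: "inv (f i) \<in> carrier F" "inv (f i) \<otimes> f i = \<one>"
    using i fi by (auto simp: field_Units)
  have c: "c \<in> carrier F" using inv fi by (simp add: c_def)
  define h where "h = sub_form d g c f"
  have ha: "h \<in> affine_forms d" unfolding h_def using fa ga c by simp
  have hi: "h i = \<zero>"
    using i fi inv c by (simp add: h_def sub_form_def c_def m_assoc)
  have aff_h: "aff d h x = aff d g x \<ominus> c \<otimes> aff d f x" if "x \<in> points d" for x
    unfolding h_def using that fa ga c by (intro aff_sub_form)
  have zp: "z \<in> points d" using z zeros_subset_points by blast
  have hz: "z \<in> zeros d h"
    using zp z aff_h[OF zp] c by (simp add: zeros_def)
  have "\<exists>l\<le>d. h l \<noteq> \<zero>"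
  proof (rule ccontr)
    assume "\<not> (\<exists>l\<le>d. h l \<noteq> \<zero>)"
    then have gcf: "g l = c \<otimes> f l" if "l \<le> d" for l
      using sub_form_eq_zeroD[OF ga fa c _ that] unfolding h_def by blast
    have ah: "aff d h x = \<zero>" if "x \<in> points d" for x
      using aff_const[OF ha that] \<open>\<not> (\<exists>l\<le>d. h l \<noteq> \<zero>)\<close> by simp
    have "c \<noteq> \<zero>"
    proof
      assume "c = \<zero>"
      then have "g l = \<zero>" if "l < d" for l using gcf[of l] that fa coeff_closed[of f d l] by simp
      then show False using g by (auto simp: nonconst_forms_def)
    qed
    have "aff d g x = \<zero> \<longleftrightarrow> aff d f x = \<zero>" if "x \<in> points d" for x
    proof -
      have "aff d g x = c \<otimes> aff d f x"
        using ah[OF that] aff_h[OF that] that fa ga c by (simp)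
      then show ?thesis using that fa c \<open>c \<noteq> \<zero>\<close> integral_iff by auto
    qed
    then show False using ne unfolding zeros_def by auto
  qed
  then have "h \<in> nonconst_forms d" using nonconst_formI[OF ha hz] by blast
  then obtain j where j: "j < d" "h j \<noteq> \<zero>" by (auto simp: nonconst_forms_def)
  have ij: "i \<noteq> j" using j hi by auto
  let ?D = "{..<d} - {i, j}"
  have "inj_on (\<lambda>x. restrict x ?D) (zeros d f \<inter> zeros d g)"
  proof (rule inj_onI)
    fix x y assume xy: "x \<in> zeros d f \<inter> zeros d g" "y \<in> zeros d f \<inter> zeros d g"
      and e: "restrict x ?D = restrict y ?D"
    have xyp: "x \<in> points d" "y \<in> points d" using xy zeros_subset_points by auto
    have l: "x l = y l" if "l < d" "l \<noteq> i" "l \<noteq> j" for l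
      using fun_cong[OF e, of l] that by simp
    have xyi: "x i \<in> carrier F" "y i \<in> carrier F" using xyp i coord_closed by auto
    \<comment> \<open>Coordinate \<open>j\<close> is recovered first, through \<open>h\<close>,
      which does not see coordinate \<open>i\<close>; then \<open>f\<close> determines coordinate
      \<open>i\<close>.\<close>
    have "h l \<otimes> x l = h l \<otimes> y l" if "l < d" "l \<noteq> j" for l
      using l[OF that(1) _ that(2)] hi xyi by (cases "l = i") auto
    moreover have "aff d h x = aff d h y"
      using xy aff_h xyp by (simp add: zeros_def)
    ultimately have "x j = y j"
      using ha xyp j by (intro aff_cancel[of h d x y j]) auto
    then have l': "x l = y l" if "l < d" "l \<noteq> i" for l using l that by metis
    then have "x i = y i"
      using xy fa xyp i by (intro aff_cancel[of f d x y i]) (auto simp: zeros_def)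
    then show "x = y"
      using xyp l' by (intro PiE_ext[of x "{..<d}" "\<lambda>_. carrier F"]) auto
  qed
  moreover have "(\<lambda>x. restrict x ?D) ` (zeros d f \<inter> zeros d g) \<subseteq> ?D \<rightarrow>\<^sub>E carrier F"
    by (intro image_subsetI restrict_PiE_iff[THEN iffD2] ballI, rule coord_closed[of _ d])
      (simp_all add: zeros_def)
  moreover have "finite (?D \<rightarrow>\<^sub>E carrier F)"
    using finite_carrier by (intro finite_PiE) auto
  ultimately have "card (zeros d f \<inter> zeros d g) \<le> card (?D \<rightarrow>\<^sub>E carrier F)"
    by (rule card_inj_on_le)
  also have "\<dots> = q ^ (d - 2)" using i j ij by (simp add: card_PiE numeral_2_eq_2)
  finally show ?thesis .
qed

section \<open>Zero sets as hyperplanes of the coordinate space\<close>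

lemma vectorspace_affine_space: "vectorspace F (affine_space F d)"
  unfolding vectorspace_def affine_space_def
  by (simp add: func_space_is_module field_axioms)

lemma add_affine_space: "x \<oplus>\<^bsub>affine_space F d\<^esub> y = (\<lambda>i\<in>{..<d}. x i \<oplus> y i)"
  and smult_affine_space: "c \<odot>\<^bsub>affine_space F d\<^esub> x = (\<lambda>i\<in>{..<d}. c \<otimes> x i)"
  by (simp_all add: affine_space_def func_space_def)

text \<open>\<open>f(d := \<zero>)\<close> is the linear part of \<open>f\<close>; the constant term
  may enter only once.\<close>

lemma aff_add:
  assumes "f \<in> affine_forms d" "x \<in> points d" "y \<in> points d"
  shows "aff d f (x \<oplus>\<^bsub>affine_space F d\<^esub> y) = aff d f x \<oplus> aff d (f(d := \<zero>)) y"
proof -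
  have c: "f d \<in> carrier F" "\<And>i. i < d \<Longrightarrow> f i \<in> carrier F" "\<And>i. i < d \<Longrightarrow> x i \<in> carrier F"
    "\<And>i. i < d \<Longrightarrow> y i \<in> carrier F"
    using assms coeff_closed coord_closed by auto
  have "(\<Oplus>i\<in>{..<d}. f i \<otimes> (\<lambda>i\<in>{..<d}. x i \<oplus> y i) i) = (\<Oplus>i\<in>{..<d}. f i \<otimes> x i \<oplus> f i \<otimes> y i)"
    using c by (intro finsum_cong') (auto simp: r_distr)
  also have "\<dots> = (\<Oplus>i\<in>{..<d}. f i \<otimes> x i) \<oplus> (\<Oplus>i\<in>{..<d}. f i \<otimes> y i)"
    using c by (intro finsum_addf) auto
  also have "(\<Oplus>i\<in>{..<d}. f i \<otimes> y i) = aff d (f(d := \<zero>)) y"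
  proof -
    have "(\<Oplus>i\<in>{..<d}. f i \<otimes> y i) = (\<Oplus>i\<in>{..<d}. (f(d := \<zero>)) i \<otimes> y i)"
      using c by (intro finsum_cong') auto
    moreover have "(\<Oplus>i\<in>{..<d}. f i \<otimes> y i) \<in> carrier F" using c by (intro finsum_closed) auto
    ultimately show ?thesis by (simp add: aff_def)
  qed
  finally have *: "(\<Oplus>i\<in>{..<d}. f i \<otimes> (\<lambda>i\<in>{..<d}. x i \<oplus> y i) i)
    = (\<Oplus>i\<in>{..<d}. f i \<otimes> x i) \<oplus> aff d (f(d := \<zero>)) y" .
  have "f(d := \<zero>) \<in> affine_forms d" using assms(1) by (auto simp: PiE_iff extensional_def)
  then have "aff d (f(d := \<zero>)) y \<in> carrier F" using assms(3) by simp
  moreover have "(\<Oplus>i\<in>{..<d}. f i \<otimes> x i) \<in> carrier F" using c by (intro finsum_closed) auto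
  ultimately show ?thesis
    unfolding add_affine_space using * c(1) by (simp add: aff_def a_assoc)
qed

lemma aff_smult:
  assumes "f \<in> affine_forms d" "f d = \<zero>" "x \<in> points d" "a \<in> carrier F"
  shows "aff d f (a \<odot>\<^bsub>affine_space F d\<^esub> x) = a \<otimes> aff d f x"
proof -
  have c: "\<And>i. i < d \<Longrightarrow> f i \<in> carrier F" "\<And>i. i < d \<Longrightarrow> x i \<in> carrier F"
    using assms coeff_closed coord_closed by auto
  have "(\<Oplus>i\<in>{..<d}. f i \<otimes> (\<lambda>i\<in>{..<d}. a \<otimes> x i) i) = (\<Oplus>i\<in>{..<d}. a \<otimes> (f i \<otimes> x i))"
    using c assms(4) by (intro finsum_cong') (auto simp: m_lcomm)
  also have "\<dots> = a \<otimes> (\<Oplus>i\<in>{..<d}. f i \<otimes> x i)"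
    using c assms(4) by (intro finsum_rdistr[symmetric]) auto
  finally have *: "(\<Oplus>i\<in>{..<d}. f i \<otimes> (\<lambda>i\<in>{..<d}. a \<otimes> x i) i) = a \<otimes> (\<Oplus>i\<in>{..<d}. f i \<otimes> x i)" .
  have "(\<Oplus>i\<in>{..<d}. f i \<otimes> x i) \<in> carrier F" using c by (intro finsum_closed) auto
  then show ?thesis
    unfolding smult_affine_space aff_def using * assms(2,4) by simp
qed

text \<open>The direction space \<open>W\<close> is the kernel of the linear part. Its size
  \<open>q ^ (d - 1)\<close> forces dimension \<open>d - 1\<close>, so no rank argument is needed.
  The coset \<open>v + W\<close> lies in the zero set of \<open>f\<close> and has the same
  size.\<close>

lemma hyperplane_zeros:
  assumes f: "f \<in> nonconst_forms d"
  shows "hyperplane F d (zeros d f)"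
proof -
  let ?V = "affine_space F d"
  interpret V: vectorspace F ?V by (rule vectorspace_affine_space)
  define f0 where "f0 = f(d := \<zero>)"
  define W where "W = zeros d f0"
  have fa: "f \<in> affine_forms d" using f by (rule nonconst_formsD)
  have f0: "f0 \<in> nonconst_forms d"
    using f unfolding f0_def nonconst_forms_def by (auto simp: PiE_iff extensional_def)
  have f0a: "f0 \<in> affine_forms d" using f0 by (rule nonconst_formsD)
  have f0d: "f0 d = \<zero>" "f0(d := \<zero>) = f0" by (simp_all add: f0_def)
  have cV: "carrier ?V = points d" by (rule carrier_affine_space)
  have WV: "W \<subseteq> carrier ?V" unfolding W_def cV by (rule zeros_subset_points)
  have Wiff: "x \<in> W \<longleftrightarrow> x \<in> carrier ?V \<and> aff d f0 x = \<zero>" for x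
    unfolding W_def cV by (simp add: zeros_def)
  have sm: "submodule F W ?V"
  proof (unfold_locales)
    show "W \<subseteq> carrier ?V" by (rule WV)
  next
    fix v w assume "v \<in> W" "w \<in> W"
    then show "v \<oplus>\<^bsub>?V\<^esub> w \<in> W"
      unfolding Wiff using aff_add[OF f0a, of v w] f0d(2) cV V.M.a_closed[of v w] by simp
  next
    \<comment> \<open>The zero vector is written as a multiple by the scalar zero, so that
      homogeneity shows that the linear part vanishes there.\<close>
    have "aff d f0 (\<zero> \<odot>\<^bsub>?V\<^esub> \<zero>\<^bsub>?V\<^esub>) = \<zero> \<otimes> aff d f0 \<zero>\<^bsub>?V\<^esub>"
      using f0a f0d(1) cV V.M.zero_closed by (intro aff_smult) simp_all
    then show "\<zero>\<^bsub>?V\<^esub> \<in> W"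
      unfolding Wiff using f0a cV V.M.zero_closed V.smult_l_null[OF V.M.zero_closed] by simp
  next
    fix c v assume "c \<in> carrier F" "v \<in> W"
    then show "c \<odot>\<^bsub>?V\<^esub> v \<in> W"
      unfolding Wiff using aff_smult[OF f0a f0d(1), of v c] cV V.smult_closed[of c v] by simp
  qed
  then have sub: "VectorSpace.subspace F W ?V"
    using vectorspace_affine_space by (simp add: VectorSpace.subspace_def)
  have d0: "0 < d" using f by (auto simp: nonconst_forms_def)
  have dim: "vectorspace.dim F (?V\<lparr>carrier := W\<rparr>) = d - 1"
  proof -
    have vs: "vectorspace F (?V\<lparr>carrier := W\<rparr>)" using V.subspace_is_vs[OF sub] .
    have "card W = q ^ vectorspace.dim F (?V\<lparr>carrier := W\<rparr>)"
      using vectorspace.card_carrier_eq_power_dim[OF vs] finite_carrier finite_zeros[of d f0]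
      by (simp add: W_def)
    moreover have "card W = q ^ (d - 1)" unfolding W_def by (rule card_zeros[OF f0])
    ultimately show ?thesis using one_less_q by simp
  qed
  have cZ: "card (zeros d f) = q ^ (d - 1)" by (rule card_zeros[OF f])
  then have "zeros d f \<noteq> {}" using one_less_q by auto
  then obtain v where v: "v \<in> zeros d f" by auto
  have vV: "v \<in> carrier ?V" using v zeros_subset_points[of d f] cV by auto
  have im: "v <+\<^bsub>?V\<^esub> W = (\<lambda>w. v \<oplus>\<^bsub>?V\<^esub> w) ` W"
    by (auto simp: a_l_coset_def')
  have "v <+\<^bsub>?V\<^esub> W \<subseteq> zeros d f"
  proof
    fix x assume "x \<in> v <+\<^bsub>?V\<^esub> W"
    then obtain w where w: "w \<in> W" "x = v \<oplus>\<^bsub>?V\<^esub> w" unfolding im by auto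
    have "x \<in> carrier ?V" unfolding w(2) using w(1) vV Wiff by (intro V.M.a_closed) simp_all
    moreover have "aff d f x = aff d f v \<oplus> aff d f0 w"
      unfolding w(2) f0_def using fa vV w(1) Wiff cV by (intro aff_add) simp_all
    ultimately show "x \<in> zeros d f"
      using v w(1) Wiff cV by (simp add: zeros_def)
  qed
  moreover have "card (v <+\<^bsub>?V\<^esub> W) = card (zeros d f)"
  proof -
    have "inj_on (\<lambda>w. v \<oplus>\<^bsub>?V\<^esub> w) W"
    proof (rule inj_onI)
      fix x y assume "x \<in> W" "y \<in> W" "v \<oplus>\<^bsub>?V\<^esub> x = v \<oplus>\<^bsub>?V\<^esub> y"
      then show "x = y" using vV Wiff by simp
    qed
    then show ?thesis unfolding im cZ by (simp add: card_image W_def card_zeros[OF f0])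
  qed
  ultimately have "zeros d f = v <+\<^bsub>?V\<^esub> W"
    using card_subset_eq[OF finite_zeros[of d f]] by metis
  then show ?thesis
    unfolding hyperplane_def affine_subspace_def using vV sub dim by metis
qed

section \<open>Sizes of sets in general position\<close>

lemma general_position_subset:
  "general_position F d S \<Longrightarrow> T \<subseteq> S \<Longrightarrow> general_position F d T"
  unfolding general_position_def by (meson subset_trans)

lemma general_position_points: "general_position F d S \<Longrightarrow> S \<subseteq> points d"
  by (simp add: general_position_def carrier_affine_space)

lemma general_position_finite: "general_position F d S \<Longrightarrow> finite S"
  by (rule finite_subset[OF general_position_points finite_points])

lemma general_position_card_zeros:
  assumes "general_position F d S" "f \<in> nonconst_forms d"
  shows "card (S \<inter> zeros d f) \<le> d"
proof (rule ccontr)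
  assume "\<not> card (S \<inter> zeros d f) \<le> d"
  then have "d + 1 \<le> card (S \<inter> zeros d f)" by simp
  then obtain T where T: "T \<subseteq> S \<inter> zeros d f" "card T = d + 1"
    by (rule obtain_subset_with_card_n)
  then have "T \<subseteq> S \<and> card T = d + 1 \<and> hyperplane F d (zeros d f) \<and> T \<subseteq> zeros d f"
    using hyperplane_zeros[OF assms(2)] by simp
  then show False
    using assms(1) unfolding general_position_def by metis
qed

text \<open>The \<open>q\<close> parallel hyperplanes on which coordinate 0 is constant cover the
  space, and each holds at most \<open>d\<close> points of \<open>S\<close>. In the proof,
  \<open>f\<close> is that coordinate and \<open>e\<close> the constant one.\<close>

lemma general_position_card:
  assumes S: "general_position F d S" and d: "0 < d"
  shows "card S \<le> q * d"
proof -
  define f where "f = (\<lambda>i\<in>{..d}. if i = 0 then \<one> else \<zero>)"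
  define e where "e = (\<lambda>i\<in>{..d}. if i = d then \<one> else \<zero>)"
  have fe: "f \<in> affine_forms d" "e \<in> affine_forms d" unfolding f_def e_def by auto
  have nc: "sub_form d f c e \<in> nonconst_forms d" if "c \<in> carrier F" for c
    using fe that d unfolding nonconst_forms_def
    by (auto simp: sub_form_def f_def e_def intro!: exI[of _ "0::nat"])
  have "aff d e x = \<one>" if "x \<in> points d" for x
    using aff_const[OF fe(2) that] by (simp add: e_def)
  then have "x \<in> zeros d (sub_form d f (aff d f x) e)" if "x \<in> points d" for x
    using that fe by (simp add: zeros_def aff_sub_form)
  then have "S \<subseteq> (\<Union>c\<in>carrier F. S \<inter> zeros d (sub_form d f c e))"
    using general_position_points[OF S] fe(1) by (intro subsetI UN_I[of "aff d f _"]) auto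
  then have "card S \<le> card (\<Union>c\<in>carrier F. S \<inter> zeros d (sub_form d f c e))"
    using finite_carrier general_position_finite[OF S] by (intro card_mono) auto
  also have "\<dots> \<le> (\<Sum>c\<in>carrier F. card (S \<inter> zeros d (sub_form d f c e)))"
    by (rule card_UN_le[OF finite_carrier])
  also have "\<dots> \<le> (\<Sum>c\<in>carrier F. d)"
    using general_position_card_zeros[OF S nc] by (intro sum_mono) auto
  finally show ?thesis by simp
qed

text \<open>
  Two forms with the same values on \<open>P\<close> differ by a form vanishing on \<open>P\<close>, and by the pigeonhole
  principle some values on \<open>P\<close> are attained by at least \<open>q\<^sup>2\<close> forms: enough for two independent
  differences.
\<close>

lemma pencil_exists:
  assumes P: "P \<subseteq> points d" "card P = d - 1" and d: "2 \<le> d"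
  obtains f g where "f \<in> affine_forms d" "g \<in> nonconst_forms d" "P \<subseteq> zeros d f" "P \<subseteq> zeros d g"
    "\<And>c. c \<in> carrier F \<Longrightarrow> sub_form d f c g \<in> nonconst_forms d"
proof -
  have finP: "finite P" using P(1) finite_points by (rule finite_subset)
  \<comment> \<open>As \<open>d - 1\<close> is positive, \<open>P\<close> has a point. It is a
    common zero of all the differences below, and \<open>nonconst_formI\<close> turns such a form
    into a nonconstant one as soon as it is nonzero.\<close>
  obtain p where p: "p \<in> P" using P(2) d by (cases "P = {}") auto
  let ?A = "affine_forms d" and ?E = "\<lambda>f. \<lambda>x\<in>P. aff d f x"
  let ?fib = "\<lambda>v. {f \<in> ?A. ?E f = v}"
  have finA: "finite ?A" and cA: "card ?A = q ^ (d + 1)"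
    using finite_carrier by (auto simp: card_PiE intro: finite_PiE)
  have finB: "finite (P \<rightarrow>\<^sub>E carrier F)" and cB: "card (P \<rightarrow>\<^sub>E carrier F) = q ^ (d - 1)"
    using finite_carrier finP P(2) by (auto simp: card_PiE intro: finite_PiE)
  have EB: "?E ` ?A \<subseteq> P \<rightarrow>\<^sub>E carrier F"
    using P(1) by (intro image_subsetI restrict_PiE_iff[THEN iffD2] ballI aff_closed) auto
  obtain v where v: "q\<^sup>2 \<le> card (?fib v)"
  proof (rule ccontr)
    assume "\<not> thesis"
    then have "card (?fib v) < q\<^sup>2" for v using that by (meson not_le)
    then have "(\<Sum>v\<in>P \<rightarrow>\<^sub>E carrier F. card (?fib v)) < (\<Sum>v\<in>P \<rightarrow>\<^sub>E carrier F. q\<^sup>2)"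
      using finB cB one_less_q by (intro sum_strict_mono) auto
    also have "\<dots> = q ^ (d - 1) * q\<^sup>2" using cB by simp
    also have "\<dots> = q ^ (d + 1)" using d by (simp flip: power_add)
    also have "(\<Sum>v\<in>P \<rightarrow>\<^sub>E carrier F. card (?fib v)) = card ?A"
      using sum.group[OF finA finB EB, of "\<lambda>_. 1::nat"] by simp
    finally show False using cA by simp
  qed
  define \<Phi> where "\<Phi> = ?fib v"
  have \<Phi>: "f \<in> \<Phi> \<longleftrightarrow> f \<in> ?A \<and> ?E f = v" for f by (simp add: \<Phi>_def)
  have v: "q\<^sup>2 \<le> card \<Phi>" using v by (simp add: \<Phi>_def)
  have q2: "1 < q\<^sup>2" "q < q\<^sup>2" 
    using one_less_q less_1_mult[of q q] by (simp_all add: power2_eq_square)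
  have van: "P \<subseteq> zeros d (sub_form d k \<one> h)" if "h \<in> \<Phi>" "k \<in> \<Phi>" for h k
  proof
    fix x assume x: "x \<in> P"
    then have xp: "x \<in> points d" using P(1) by auto
    have "aff d h x = aff d k x" 
    proof -
      have "restrict (aff d h) P x = restrict (aff d k) P x" using that by (simp add: \<Phi>)
      then show ?thesis using x by simp
    qed
    then show "x \<in> zeros d (sub_form d k \<one> h)"
      using that xp by (simp add: zeros_def aff_sub_form \<Phi>)
  qed
  have "\<Phi> \<noteq> {}" using v q2 by fastforce
  then obtain h where h: "h \<in> \<Phi>" by auto
  then have ha: "h \<in> ?A" by (simp add: \<Phi>)
  have "\<not> \<Phi> \<subseteq> {h}"
  proof
    assume "\<Phi> \<subseteq> {h}"
    then have "card \<Phi> \<le> card {h}" by (intro card_mono) simp_all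
    then show False using v q2 by simp
  qed
  then obtain k where k: "k \<in> \<Phi>" "k \<noteq> h" by auto
  then have ka: "k \<in> ?A" by (simp add: \<Phi>)
  define g where "g = sub_form d k \<one> h"
  have ga: "g \<in> ?A" unfolding g_def using ha ka by simp
  have gz: "P \<subseteq> zeros d g" unfolding g_def by (rule van[OF h k(1)])
  have g: "g \<in> nonconst_forms d"
  proof (rule ccontr)
    assume "g \<notin> nonconst_forms d"
    then have "g i = \<zero>" if "i \<le> d" for i
      using nonconst_formI[OF ga _ that, of p] gz p by (metis subsetD)
    then have "k i = \<one> \<otimes> h i" if "i \<le> d" for i
      using sub_form_eq_zeroD[OF ka ha one_closed _ that] unfolding g_def by metis
    then have "k i = h i" if "i \<le> d" for i using that coeff_closed[OF ha] by simp
    then have "k = h" using PiE_ext[OF ka ha] by simp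
    then show False using k by simp
  qed
  \<comment> \<open>The line of forms \<open>h - c g\<close> has at most \<open>q\<close> members,
    fewer than \<open>q\<^sup>2\<close>, so some \<open>l\<close> in \<open>\<Phi>\<close> lies off
    it; this makes \<open>l - h\<close> independent of \<open>g\<close>.\<close>
  have "card ((\<lambda>c. sub_form d h c g) ` carrier F) < card (\<Phi>)"
    using card_image_le[OF finite_carrier, of "\<lambda>c. sub_form d h c g"] v q2 by simp
  then have "\<not> \<Phi> \<subseteq> (\<lambda>c. sub_form d h c g) ` carrier F"
    using card_mono[of "(\<lambda>c. sub_form d h c g) ` carrier F" "\<Phi>"] finite_carrier
    by (meson finite_imageI not_le)
  then obtain l where l: "l \<in> \<Phi>" "l \<notin> (\<lambda>c. sub_form d h c g) ` carrier F" by blast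
  then have la: "l \<in> ?A" by (simp add: \<Phi>)
  define f where "f = sub_form d l \<one> h"
  have fa: "f \<in> ?A" unfolding f_def using ha la by simp
  have fz: "P \<subseteq> zeros d f" unfolding f_def by (rule van[OF h l(1)])
  have "sub_form d f c g \<in> nonconst_forms d" if c: "c \<in> carrier F" for c
  proof (rule ccontr)
    assume n: "sub_form d f c g \<notin> nonconst_forms d"
    have sa: "sub_form d f c g \<in> ?A" using fa ga c by simp
    have pp: "p \<in> points d" using p P(1) by auto
    have "aff d f p = \<zero>" "aff d g p = \<zero>" using fz gz p by (auto simp: zeros_def)
    then have "p \<in> zeros d (sub_form d f c g)"
      using fa ga c pp by (simp add: zeros_def aff_sub_form)
    then have "sub_form d f c g i = \<zero>" if "i \<le> d" for i
      using nonconst_formI[OF sa _ that, of p] n by metis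
    then have e: "f i = c \<otimes> g i" if "i \<le> d" for i
      using sub_form_eq_zeroD[OF fa ga c _ that] by metis
    \<comment> \<open>From \<open>f = c g\<close> it would follow that \<open>l = h + c g\<close>, a
      form on the line that \<open>l\<close> avoids.\<close>
    have "l i = sub_form d h (\<ominus> c) g i" if i: "i \<le> d" for i
    proof -
      have cl: "l i \<in> carrier F" "h i \<in> carrier F" "g i \<in> carrier F"
        using coeff_closed la ha ga i by auto
      have "l i \<ominus> h i = c \<otimes> g i" using e[OF i] i cl by (simp add: f_def sub_form_def)
      then have "l i = h i \<oplus> c \<otimes> g i"
        using cl c by (metis a_minus_def a_assoc a_comm add.inv_closed l_neg r_zero m_closed)
      then show ?thesis using i cl c by (simp add: sub_form_def a_minus_def l_minus)
    qed
    then have "l = sub_form d h (\<ominus> c) g"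
      using PiE_ext[OF la, of "sub_form d h (\<ominus> c) g"] ha ga c by simp
    then show False using l(2) c by blast
  qed
  from that[OF fa g fz gz this] show thesis .
qed

section \<open>Containers for sets in general position\<close>

text \<open>The pencil consists of \<open>g\<close> and the \<open>q\<close> forms
  \<open>f - c g\<close>. The member through \<open>x\<close> is \<open>g\<close> if
  \<open>g\<close> vanishes at \<open>x\<close>, and otherwise has \<open>c = f(x) / g(x)\<close>.
  The inequality is Cauchy-Schwarz over these \<open>q + 1\<close> members, each fibre of
  \<open>h\<close> lying on its hyperplane.\<close>

lemma hyperplane_choice_exists:
  assumes P: "P \<subseteq> points d" "card P = d - 1" and d: "2 \<le> d"
  obtains h where "\<And>x. x \<in> points d \<Longrightarrow> h x \<in> nonconst_forms d \<and> insert x P \<subseteq> zeros d (h x)"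
    "\<And>U. U \<subseteq> points d \<Longrightarrow> (card U)\<^sup>2 \<le> (q + 1) * (\<Sum>x\<in>U. card (U \<inter> zeros d (h x)))"
proof -
  obtain f g where fg: "f \<in> affine_forms d" "g \<in> nonconst_forms d" "P \<subseteq> zeros d f" "P \<subseteq> zeros d g"
    "\<And>c. c \<in> carrier F \<Longrightarrow> sub_form d f c g \<in> nonconst_forms d"
    using pencil_exists[OF P d] by metis
  have ga: "g \<in> affine_forms d" using fg(2) by (rule nonconst_formsD)
  define h where "h x = (if aff d g x = \<zero> then g
    else sub_form d f (aff d f x \<otimes> inv (aff d g x)) g)" for x
  let ?K = "insert g ((\<lambda>c. sub_form d f c g) ` carrier F)"
  have Pz: "P \<subseteq> zeros d (sub_form d f c g)" if "c \<in> carrier F" for c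
  proof
    fix p assume p: "p \<in> P"
    then have "p \<in> points d" "aff d f p = \<zero>" "aff d g p = \<zero>"
      using fg(3,4) by (auto simp: zeros_def)
    then show "p \<in> zeros d (sub_form d f c g)"
      using that fg(1) ga by (simp add: zeros_def aff_sub_form)
  qed
  have h: "h x \<in> ?K" "h x \<in> nonconst_forms d" "insert x P \<subseteq> zeros d (h x)"
    if x: "x \<in> points d" for x
  proof -
    have ac: "aff d f x \<in> carrier F" "aff d g x \<in> carrier F" using fg(1) ga x by simp_all
    have "h x \<in> ?K \<and> h x \<in> nonconst_forms d \<and> insert x P \<subseteq> zeros d (h x)"
    proof (cases "aff d g x = \<zero>")
      case True
      then show ?thesis using x fg(2,4) by (simp add: h_def zeros_def)
    next
      case False
      then have inv: "inv (aff d g x) \<in> carrier F" "inv (aff d g x) \<otimes> aff d g x = \<one>"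
        using ac by (auto simp: field_Units)
      define c where "c = aff d f x \<otimes> inv (aff d g x)"
      have c: "c \<in> carrier F" using inv ac by (simp add: c_def)
      have "c \<otimes> aff d g x = aff d f x"
        unfolding c_def using inv ac by (simp add: m_assoc)
      then have "x \<in> zeros d (sub_form d f c g)"
        using x fg(1) ga c ac by (simp add: zeros_def aff_sub_form)
      moreover have "h x = sub_form d f c g" using False by (simp add: h_def c_def)
      ultimately show ?thesis using c fg(5)[OF c] Pz[OF c] by simp
    qed
    then show "h x \<in> ?K" "h x \<in> nonconst_forms d" "insert x P \<subseteq> zeros d (h x)" by auto
  qed
  have cK: "card ?K \<le> q + 1"
  proof -
    have "card ?K \<le> Suc (card ((\<lambda>c. sub_form d f c g) ` carrier F))"
      by (rule card_insert_le_m1) auto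
    also have "\<dots> \<le> q + 1" using card_image_le[OF finite_carrier] by simp
    finally show ?thesis .
  qed
  have "(card U)\<^sup>2 \<le> (q + 1) * (\<Sum>x\<in>U. card (U \<inter> zeros d (h x)))" if U: "U \<subseteq> points d" for U
  proof -
    have finU: "finite U" using U finite_points by (rule finite_subset)
    have "h ` U \<subseteq> ?K" using h(1) U by (intro image_subsetI) (rule h(1), rule subsetD)
    then have "(card U)\<^sup>2 \<le> card ?K * (\<Sum>x\<in>U. card {y\<in>U. h y = h x})"
      using finU finite_carrier by (intro card_squared_le_sum_fibres) simp_all
    also have "\<dots> \<le> (q + 1) * (\<Sum>x\<in>U. card (U \<inter> zeros d (h x)))"
    proof (intro mult_le_mono cK sum_mono card_mono)
      fix x assume "x \<in> U"
      show "{y \<in> U. h y = h x} \<subseteq> U \<inter> zeros d (h x)"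
      proof
        fix y assume y: "y \<in> {y \<in> U. h y = h x}"
        then have "y \<in> points d" using U by auto
        from h(3)[OF this] y show "y \<in> U \<inter> zeros d (h x)" by auto
      qed
    qed (use finU in simp)
    finally show ?thesis .
  qed
  moreover have "h x \<in> nonconst_forms d \<and> insert x P \<subseteq> zeros d (h x)" if "x \<in> points d" for x
    using h(2,3)[OF that] by simp
  ultimately show thesis using that by metis
qed

section \<open>Degrees and independent sets of the graph\<close>

text \<open>Loops are allowed, so that a whole hyperplane section through \<open>x\<close> counts
  towards the degree of \<open>x\<close>; independence is tested only on distinct points.\<close>

definition joined :: "nat \<Rightarrow> (nat \<Rightarrow> 'a) set set \<Rightarrow> (nat \<Rightarrow> 'a) \<Rightarrow> (nat \<Rightarrow> 'a) \<Rightarrow> bool" where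
  "joined d \<P> x y \<longleftrightarrow> (\<exists>P\<in>\<P>. \<exists>f\<in>nonconst_forms d. insert x (insert y P) \<subseteq> zeros d f)"

text \<open>The sections through a well-chosen \<open>x\<close> have large total size. Two
  corrections lead from this total to the number of neighbours: the factor \<open>2 ^ d\<close> for
  hyperplanes arising from several \<open>P\<close>, and the last summand for overlaps of distinct
  hyperplanes.\<close>

lemma joined_degree:
  assumes T: "general_position F d T" and d: "2 \<le> d"
    and \<P>: "\<P> \<subseteq> {P. P \<subseteq> T \<and> card P = d - 1}"
    and U: "U \<subseteq> points d" "U \<noteq> {}"
  defines "M \<equiv> card \<P>"
  shows "\<exists>x\<in>U. M * card U \<le>
    (q + 1) * 2 ^ d * (card {y\<in>U. joined d \<P> x y} + M * (M - 1) * q ^ (d - 2))"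
proof -
  have finU: "finite U" using U(1) finite_points by (rule finite_subset)
  have finT: "finite T" by (rule general_position_finite[OF T])
  have "\<P> \<subseteq> Pow T" using \<P> by auto
  then have fin\<P>: "finite \<P>" using finT by (simp add: finite_subset)
  have "\<exists>h. (\<forall>x\<in>points d. h x \<in> nonconst_forms d \<and> insert x P \<subseteq> zeros d (h x)) \<and>
    (card U)\<^sup>2 \<le> (q + 1) * (\<Sum>x\<in>U. card (U \<inter> zeros d (h x)))" if "P \<in> \<P>" for P
  proof -
    have P: "P \<subseteq> points d" "card P = d - 1"
      using that \<P> general_position_points[OF T] by auto
    show ?thesis using hyperplane_choice_exists[OF P d] U(1) by metis
  qed
  then obtain h where
    h: "\<And>P x. P \<in> \<P> \<Longrightarrow> x \<in> points d \<Longrightarrow> h P x \<in> nonconst_forms d \<and> insert x P \<subseteq> zeros d (h P x)"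
    and hs: "\<And>P. P \<in> \<P> \<Longrightarrow> (card U)\<^sup>2 \<le> (q + 1) * (\<Sum>x\<in>U. card (U \<inter> zeros d (h P x)))"
    by metis
  define c where "c P x = card (U \<inter> zeros d (h P x))" for P x
  \<comment> \<open>Averaging: if every \<open>x\<close> failed, summing over \<open>U\<close> would
    contradict the sum of the pencil inequalities \<open>hs\<close> over all
    \<open>P\<close>.\<close>
  obtain x where x: "x \<in> U" "M * card U \<le> (q + 1) * (\<Sum>P\<in>\<P>. c P x)"
  proof (rule ccontr)
    assume "\<not> thesis"
    then have "\<And>x. x \<in> U \<Longrightarrow> (q + 1) * (\<Sum>P\<in>\<P>. c P x) < M * card U"
      using that by (meson not_le)
    then have "(\<Sum>x\<in>U. (q + 1) * (\<Sum>P\<in>\<P>. c P x)) < (\<Sum>x\<in>U. M * card U)"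
      using finU U(2) by (intro sum_strict_mono) auto
    also have "\<dots> = M * (card U)\<^sup>2" by (simp add: power2_eq_square)
    also have "(\<Sum>x\<in>U. (q + 1) * (\<Sum>P\<in>\<P>. c P x)) = (\<Sum>P\<in>\<P>. (q + 1) * (\<Sum>x\<in>U. c P x))"
      unfolding sum_distrib_left[symmetric] by (subst sum.swap) (rule refl)
    finally have "(\<Sum>P\<in>\<P>. (q + 1) * (\<Sum>x\<in>U. c P x)) < M * (card U)\<^sup>2" .
    moreover have "(\<Sum>P\<in>\<P>. (card U)\<^sup>2) \<le> (\<Sum>P\<in>\<P>. (q + 1) * (\<Sum>x\<in>U. c P x))"
      unfolding c_def by (intro sum_mono hs)
    ultimately show False by (simp add: M_def)
  qed
  have xp: "x \<in> points d" using x(1) U(1) by auto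
  define Z where "Z P = zeros d (h P x)" for P
  let ?H = "Z ` \<P>"
  have finH: "finite ?H" using fin\<P> by simp
  \<comment> \<open>Every \<open>P\<close> that yields \<open>A\<close> is a subset of
    \<open>T \<inter> A\<close>, which has at most \<open>d\<close> points.\<close>
  have fibre: "card {P\<in>\<P>. Z P = A} \<le> 2 ^ d" if A: "A \<in> ?H" for A
  proof -
    obtain P0 where P0: "P0 \<in> \<P>" "A = Z P0" using A by auto
    have "card (T \<inter> A) \<le> d"
      unfolding P0(2) Z_def using h[OF P0(1) xp] by (intro general_position_card_zeros[OF T]) simp
    have "{P\<in>\<P>. Z P = A} \<subseteq> Pow (T \<inter> A)"
    proof
      fix P assume P: "P \<in> {P\<in>\<P>. Z P = A}"
      then have "P \<subseteq> T" using \<P> by auto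
      moreover have "P \<subseteq> A" using h[of P x] xp P by (simp add: Z_def)
      ultimately show "P \<in> Pow (T \<inter> A)" by simp
    qed
    then have "card {P\<in>\<P>. Z P = A} \<le> card (Pow (T \<inter> A))"
      using finT by (intro card_mono) simp_all
    also have "\<dots> = 2 ^ card (T \<inter> A)" using finT by (intro card_Pow) simp
    also have "\<dots> \<le> 2 ^ d" using \<open>card (T \<inter> A) \<le> d\<close> by (rule power_increasing) simp
    finally show ?thesis .
  qed
  \<comment> \<open>The sum is grouped by zero sets, because the overlap bound holds only for
    distinct ones.\<close>
  have "(\<Sum>P\<in>\<P>. c P x) = (\<Sum>A\<in>?H. \<Sum>P | P \<in> \<P> \<and> Z P = A. card (U \<inter> Z P))"
    unfolding c_def Z_def[symmetric]
    by (rule sum.group[OF fin\<P> finH subset_refl, symmetric])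
  also have "\<dots> = (\<Sum>A\<in>?H. card {P\<in>\<P>. Z P = A} * card (U \<inter> A))"
    by (intro sum.cong refl) simp
  also have "\<dots> \<le> (\<Sum>A\<in>?H. 2 ^ d * card (U \<inter> A))"
    by (intro sum_mono mult_le_mono1 fibre)
  also have "\<dots> = 2 ^ d * (\<Sum>A\<in>?H. card (U \<inter> A))" by (simp add: sum_distrib_left)
  also have "(\<Sum>A\<in>?H. card (U \<inter> A)) \<le> card (\<Union>A\<in>?H. U \<inter> A) + card ?H * (card ?H - 1) * q ^ (d - 2)"
  proof (rule sum_card_le_card_UN[OF finH])
    fix A B assume AB: "A \<in> ?H" "B \<in> ?H" "A \<noteq> B"
    then obtain P Q where PQ: "P \<in> \<P>" "A = zeros d (h P x)" "Q \<in> \<P>" "B = zeros d (h Q x)"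
      by (auto simp: Z_def)
    have "card ((U \<inter> A) \<inter> (U \<inter> B)) \<le> card (A \<inter> B)"
      unfolding PQ using finite_zeros by (intro card_mono) auto
    \<comment> \<open>The point \<open>x\<close> lies on both hyperplanes, so they are not
      parallel.\<close>
    also have "\<dots> \<le> q ^ (d - 2)"
      using AB(3) h[OF PQ(1) xp] h[OF PQ(3) xp] unfolding PQ(2,4)
      by (intro card_zeros_Int[of _ d _ x]) simp_all
    finally show "card ((U \<inter> A) \<inter> (U \<inter> B)) \<le> q ^ (d - 2)" .
  qed (use finU in simp)
  also have "card (\<Union>A\<in>?H. U \<inter> A) \<le> card {y\<in>U. joined d \<P> x y}"
  proof (rule card_mono)
    show "(\<Union>A\<in>?H. U \<inter> A) \<subseteq> {y\<in>U. joined d \<P> x y}"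
    proof
      fix y assume "y \<in> (\<Union>A\<in>?H. U \<inter> A)"
      then obtain P where P: "P \<in> \<P>" "y \<in> U" "y \<in> zeros d (h P x)" by (auto simp: Z_def)
      then show "y \<in> {y\<in>U. joined d \<P> x y}"
        unfolding joined_def using h[OF P(1) xp]
        by (intro CollectI conjI bexI[of _ P] bexI[of _ "h P x"]) simp_all
    qed
  qed (use finU in simp)
  also have "card ?H * (card ?H - 1) * q ^ (d - 2) \<le> M * (M - 1) * q ^ (d - 2)"
    using card_image_le[OF fin\<P>, of Z] unfolding M_def by (intro mult_le_mono1 mult_le_mono) auto
  finally have "(\<Sum>P\<in>\<P>. c P x)
      \<le> 2 ^ d * (card {y\<in>U. joined d \<P> x y} + M * (M - 1) * q ^ (d - 2))"
    by simp
  then have "(q + 1) * (\<Sum>P\<in>\<P>. c P x)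
      \<le> (q + 1) * (2 ^ d * (card {y\<in>U. joined d \<P> x y} + M * (M - 1) * q ^ (d - 2)))"
    by (rule mult_le_mono2)
  with x(2) have "M * card U
      \<le> (q + 1) * (2 ^ d * (card {y\<in>U. joined d \<P> x y} + M * (M - 1) * q ^ (d - 2)))"
    by (rule order_trans)
  then show ?thesis using x(1) unfolding mult.assoc by (rule bexI)
qed

text \<open>As \<open>P\<close> lies in \<open>T\<close> and \<open>x\<close>, \<open>y\<close> do
  not, an edge would put \<open>d + 1\<close> different points of \<open>S\<close> on one
  hyperplane.\<close>

lemma joined_independent:
  assumes S: "general_position F d S" "T \<subseteq> S" and d: "2 \<le> d"
    and \<P>: "\<P> \<subseteq> {P. P \<subseteq> T \<and> card P = d - 1}"
    and xy: "x \<in> S - T" "y \<in> S - T" "x \<noteq> y"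
  shows "\<not> joined d \<P> x y"
proof
  assume "joined d \<P> x y"
  then obtain P f where P: "P \<in> \<P>" "f \<in> nonconst_forms d" "insert x (insert y P) \<subseteq> zeros d f"
    by (auto simp: joined_def)
  have PT: "P \<subseteq> T" "card P = d - 1" using \<P> P(1) by auto
  have finS: "finite S" by (rule general_position_finite[OF S(1)])
  have "P \<subseteq> S" using PT(1) S(2) by simp
  then have finP: "finite P" using finS by (rule finite_subset)
  have "x \<notin> P" "y \<notin> P" using PT xy by auto
  then have "card (insert x (insert y P)) = d + 1" using finP PT(2) xy(3) d by simp
  moreover have "insert x (insert y P) \<subseteq> S \<inter> zeros d f" using P(3) \<open>P \<subseteq> S\<close> xy by simp
  ultimately have "d + 1 \<le> card (S \<inter> zeros d f)" using finS card_mono by (metis finite_Int)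
  then show False using general_position_card_zeros[OF S(1) P(2)] by simp
qed

section \<open>Assembling the containers\<close>

text \<open>The graph depends on \<open>T\<close> only, so one run of the algorithm serves every
  \<open>S\<close> containing \<open>T\<close>. The assumption \<open>degree\<close> collects all
  the arithmetic needed to turn \<open>joined_degree\<close> into a degree of at least
  \<open>\<beta> * n\<close>.\<close>

lemma containers_extending:
  fixes \<beta> B :: real
  assumes T: "general_position F d T" and d: "2 \<le> d" and M: "M \<le> card T choose (d - 1)"
    and \<beta>: "\<beta> \<le> 1" and B: "0 \<le> B"
    and degree: "\<And>n :: nat. B < n \<Longrightarrow> 
      \<beta> * n \<le> real M * n / real ((q + 1) * 2 ^ d) - real (M * (M - 1) * q ^ (d - 2))"
    and j: "q ^ d * (1 - \<beta>) ^ j \<le> B"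
  shows "\<exists>\<C>. finite \<C> \<and> card \<C> \<le> (q ^ d + 1) ^ j \<and> (\<forall>C\<in>\<C>. C \<subseteq> points d) \<and>
    (\<forall>S. general_position F d S \<and> T \<subseteq> S \<longrightarrow> (\<exists>C\<in>\<C>. S \<subseteq> C \<and> card C \<le> B + card S))"
proof -
  have finT: "finite T" by (rule general_position_finite[OF T])
  have "M \<le> card {P. P \<subseteq> T \<and> card P = d - 1}" using M n_subsets[OF finT] by simp
  then obtain \<P> where \<P>: "\<P> \<subseteq> {P. P \<subseteq> T \<and> card P = d - 1}" "card \<P> = M"
    by (rule obtain_subset_with_card_n)
  have deg: "\<exists>x\<in>U. \<beta> * card U \<le> card {y\<in>U. joined d \<P> x y}"
    if U: "U \<subseteq> points d" "B < card U" for U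
  proof -
    have ne: "U \<noteq> {}" using U(2) B by (cases "U = {}") simp_all
    obtain x where x: "x \<in> U" "M * card U \<le>
        (q + 1) * 2 ^ d * (card {y\<in>U. joined d \<P> x y} + M * (M - 1) * q ^ (d - 2))"
      using joined_degree[OF T d \<P>(1) U(1) ne] unfolding \<P>(2) by (rule bexE)
    have "real (M * card U) \<le>
        real ((q + 1) * 2 ^ d * (card {y\<in>U. joined d \<P> x y} + M * (M - 1) * q ^ (d - 2)))"
      using x(2) unfolding of_nat_le_iff .
    then have "real M * card U \<le> real (card {y\<in>U. joined d \<P> x y} + M * (M - 1) * q ^ (d - 2))
        * real ((q + 1) * 2 ^ d)"
      unfolding of_nat_mult[of "(q + 1) * 2 ^ d"] of_nat_mult[of M] by (simp only: mult.commute)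
    then have "real M * card U / real ((q + 1) * 2 ^ d) \<le>
        real (card {y\<in>U. joined d \<P> x y} + M * (M - 1) * q ^ (d - 2))"
      by (subst pos_divide_le_eq) (simp_all only: of_nat_0_less_iff, simp)
    then have "\<beta> * card U \<le> card {y\<in>U. joined d \<P> x y}"
      using degree[OF U(2)] unfolding of_nat_add by linarith
    then show ?thesis using x(1) by (rule bexI)
  qed
  have "real (card (points d)) * (1 - \<beta>) ^ j \<le> B" using j card_points[of d] by simp
  from independent_set_containers[OF finite_points[of d] \<beta> deg subset_refl this]
  obtain \<D> where DD: "finite \<D> \<and> card \<D> \<le> (q ^ d + 1) ^ j \<and> (\<forall>C\<in>\<D>. C \<subseteq> points d) \<and>
    (\<forall>I \<subseteq> points d. (\<forall>x\<in>I. \<forall>y\<in>I. x \<noteq> y \<longrightarrow> \<not> joined d \<P> x y) \<longrightarrow>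
      (\<exists>C\<in>\<D>. I \<subseteq> C \<and> card C \<le> B + card I))"
    unfolding card_points by (rule exE)
  then have D: "finite \<D>" "card \<D> \<le> (q ^ d + 1) ^ j" "\<forall>C\<in>\<D>. C \<subseteq> points d"
    and DI: "\<forall>I \<subseteq> points d. (\<forall>x\<in>I. \<forall>y\<in>I. x \<noteq> y \<longrightarrow> \<not> joined d \<P> x y) \<longrightarrow>
      (\<exists>C\<in>\<D>. I \<subseteq> C \<and> card C \<le> B + card I)"
    by - (elim conjE, assumption)+
  \<comment> \<open>The algorithm covers \<open>S - T\<close>; putting \<open>T\<close> back adds
    \<open>card T\<close>, which raises \<open>card (S - T)\<close> in the size bound exactly to
    \<open>card S\<close>.\<close>
  let ?C = "(\<lambda>C. T \<union> C) ` \<D>"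
  have "card ?C \<le> (q ^ d + 1) ^ j" using card_image_le[OF D(1)] D(2) by (rule order_trans)
  moreover have "\<forall>C\<in>?C. C \<subseteq> points d" using D(3) general_position_points[OF T] by simp
  moreover have "\<exists>C\<in>?C. S \<subseteq> C \<and> card C \<le> B + card S"
    if S: "general_position F d S" "T \<subseteq> S" for S
  proof -
    have finS: "finite S" by (rule general_position_finite[OF S(1)])
    have "S - T \<subseteq> points d" using general_position_points[OF S(1)] by (rule subset_trans[OF Diff_subset])
    then obtain C where C: "C \<in> \<D>" "S - T \<subseteq> C" "card C \<le> B + card (S - T)"
      using DI[rule_format, of "S - T"] joined_independent[OF S d \<P>(1)] by metis
    have "card (T \<union> C) \<le> card T + card C" by (rule card_Un_le)
    moreover have "card S = card T + card (S - T)"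
      using finS finT S(2) card_mono[OF finS S(2)] by (simp add: card_Diff_subset)
    ultimately have "card (T \<union> C) \<le> B + card S" using C(3) by linarith
    then show ?thesis using C(1,2) by (intro bexI[of _ "T \<union> C"]) auto
  qed
  ultimately show ?thesis using D(1) by (intro exI[of _ ?C]) simp
qed

text \<open>Every \<open>T\<close> with at most \<open>s\<close> points gets its own family, which
  costs a factor \<open>(q ^ d + 1) ^ s\<close>. One bound \<open>L\<close> can serve all containers
  because a set in general position has at most \<open>q * d\<close> points.\<close>

lemma general_position_containers:
  fixes \<beta> B L :: real
  assumes d: "2 \<le> d" and M: "M \<le> s choose (d - 1)"
    and \<beta>: "\<beta> \<le> 1" and B: "0 \<le> B"
    and degree: "\<And>n :: nat. B < n \<Longrightarrow> 
      \<beta> * n \<le> real M * n / real ((q + 1) * 2 ^ d) - real (M * (M - 1) * q ^ (d - 2))"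
    and j: "q ^ d * (1 - \<beta>) ^ j \<le> B" and L: "B + q * d \<le> L"
  shows "\<exists>\<C>. (\<forall>C\<in>\<C>. C \<subseteq> points d) \<and> (\<forall>S. general_position F d S \<longrightarrow> (\<exists>C\<in>\<C>. S \<subseteq> C)) \<and>
    (\<forall>C\<in>\<C>. card C \<le> L) \<and> card \<C> \<le> (q ^ d + 1) ^ (s + j)"
proof -
  define \<T> where "\<T> = {T. general_position F d T \<and> card T \<le> s}"
  have sub: "\<T> \<subseteq> {T. T \<subseteq> points d \<and> card T \<le> s}"
    unfolding \<T>_def using general_position_points by (intro Collect_mono) metis
  have fin': "finite {T. T \<subseteq> points d \<and> card T \<le> s}"
    using finite_points[of d] by (simp add: finite_subset[of _ "Pow (points d)"] subset_iff)
  have fin\<T>: "finite \<T>" using sub fin' by (rule finite_subset)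
  have card\<T>: "card \<T> \<le> (q ^ d + 1) ^ s"
    using card_mono[OF fin' sub] card_bounded_subsets_le[OF finite_points[of d], of s]
    unfolding card_points by (rule order_trans)
  \<comment> \<open>Sets with fewer than \<open>s\<close> points have no subset \<open>T\<close> of size \<open>s\<close> and serve as their own containers.\<close>
  define good where "good T \<C> \<longleftrightarrow> finite \<C> \<and> card \<C> \<le> (q ^ d + 1) ^ j \<and> (\<forall>C\<in>\<C>. C \<subseteq> points d) \<and>
    (\<forall>S. general_position F d S \<and> T \<subseteq> S \<and> (card T < s \<longrightarrow> S = T) \<longrightarrow>
      (\<exists>C\<in>\<C>. S \<subseteq> C \<and> card C \<le> B + card S))" for T \<C>
  have "\<exists>\<C>. good T \<C>" if T: "T \<in> \<T>" for T
  proof (cases "card T < s")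
    case True
    have "good T {T}"
      using T True B general_position_points[of d T] unfolding good_def \<T>_def by simp
    then show ?thesis by blast
  next
    case False
    then have "card T = s" and gT: "general_position F d T" using T by (auto simp: \<T>_def)
    with containers_extending[OF gT d _ \<beta> B degree j] M obtain \<C> where
      "finite \<C>" "card \<C> \<le> (q ^ d + 1) ^ j" "\<forall>C\<in>\<C>. C \<subseteq> points d"
      "\<forall>S. general_position F d S \<and> T \<subseteq> S \<longrightarrow> (\<exists>C\<in>\<C>. S \<subseteq> C \<and> card C \<le> B + card S)"
      by metis
    then have "good T \<C>" unfolding good_def by metis
    then show ?thesis by blast
  qed
  then obtain fam where fam: "\<And>T. T \<in> \<T> \<Longrightarrow> good T (fam T)" by metis
  \<comment> \<open>Oversized members are discarded. The container found for a set \<open>S\<close>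
    has at most \<open>B + card S \<le> L\<close> points and survives.\<close>
  define \<C> where "\<C> = {C \<in> (\<Union>T\<in>\<T>. fam T). card C \<le> L}"
  have finU: "finite (\<Union>T\<in>\<T>. fam T)" using fin\<T> fam by (auto simp: good_def)
  have "card \<C> \<le> card (\<Union>T\<in>\<T>. fam T)" unfolding \<C>_def using finU by (intro card_mono) auto
  also have "\<dots> \<le> (\<Sum>T\<in>\<T>. card (fam T))" by (rule card_UN_le[OF fin\<T>])
  also have "\<dots> \<le> (\<Sum>T\<in>\<T>. (q ^ d + 1) ^ j)" using fam by (intro sum_mono) (simp add: good_def)
  also have "\<dots> = card \<T> * (q ^ d + 1) ^ j" by simp
  also have "\<dots> \<le> (q ^ d + 1) ^ s * (q ^ d + 1) ^ j" using card\<T> by (rule mult_le_mono1)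
  also have "\<dots> = (q ^ d + 1) ^ (s + j)" by (simp add: power_add)
  finally have "card \<C> \<le> (q ^ d + 1) ^ (s + j)" .
  moreover have "C \<subseteq> points d" "card C \<le> L" if "C \<in> \<C>" for C
    using that fam unfolding \<C>_def good_def by auto
  moreover have "\<exists>C\<in>\<C>. S \<subseteq> C" if S: "general_position F d S" for S
  proof -
    have "\<exists>T \<in> \<T>. T \<subseteq> S \<and> (card T < s \<longrightarrow> S = T)"
    proof (cases "card S < s")
      case True
      then show ?thesis using S by (intro bexI[of _ S]) (simp_all add: \<T>_def)
    next
      case False
      then have "s \<le> card S" by simp
      then obtain T where T: "T \<subseteq> S" "card T = s" by (rule obtain_subset_with_card_n)
      then show ?thesis using general_position_subset[OF S T(1)]
        by (intro bexI[of _ T]) (simp_all add: \<T>_def)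
    qed
    then obtain T where T: "T \<in> \<T>" "T \<subseteq> S" "card T < s \<longrightarrow> S = T" by auto
    then obtain C where C: "C \<in> fam T" "S \<subseteq> C" "card C \<le> B + card S"
      using fam[OF T(1)] S unfolding good_def by metis
    have "card S \<le> q * d" using d by (intro general_position_card[OF S]) simp
    then have "card C \<le> L" using C(3) L by (simp flip: of_nat_mult)
    then show ?thesis using C T(1) unfolding \<C>_def by auto
  qed
  ultimately show ?thesis by (intro exI[of _ \<C>]) simp
qed

end

section \<open>Choice of the parameters\<close>

text \<open>Two uses of the upper bound on \<open>k\<close>: about \<open>Q powr (1 / d)\<close>
  points have enough \<open>(d - 1)\<close>-subsets, and choosing that many points stays within the
  exponent \<open>Q ^ (d - 1) / k\<close>.\<close>

lemma powr_bounds: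
  fixes Q k :: real and d :: nat
  assumes d: "2 \<le> d" and Q: "2 \<le> Q" and k: "0 < k" "k \<le> Q powr (real d - 1 - 1 / real d)"
  shows "k / Q ^ (d - 2) \<le> Q powr (1 - 1 / d)" and "Q powr (1 / d) \<le> Q ^ (d - 1) / k"
proof -
  have p: "Q ^ (d - 2) = Q powr (real d - 2)" "Q ^ (d - 1) = Q powr (real d - 1)"
    using Q d by (simp_all flip: powr_realpow)
  have "Q powr (1 - 1 / d) * Q ^ (d - 2) = Q powr (real d - 1 - 1 / real d)"
    unfolding p powr_add[symmetric] by (rule arg_cong[of _ _ "(powr) Q"]) simp
  then show "k / Q ^ (d - 2) \<le> Q powr (1 - 1 / d)"
    using k Q by (subst pos_divide_le_eq) simp_all
  have "Q powr (1 / d) * k \<le> Q powr (1 / d) * Q powr (real d - 1 - 1 / real d)"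
    using k by (intro mult_left_mono) simp_all
  also have "\<dots> = Q ^ (d - 1)"
    unfolding p powr_add[symmetric] by (rule arg_cong[of _ _ "(powr) Q"]) simp
  finally show "Q powr (1 / d) \<le> Q ^ (d - 1) / k"
    using k by (subst pos_le_divide_eq) simp_all
qed

text \<open>For a multiple of \<open>d - 1\<close> the bound \<open>(n / k) ^ k\<close> on a
  binomial coefficient becomes \<open>m ^ (d - 1)\<close>. The factor 2 in the bound on
  \<open>m\<close> absorbs the summand 1 in the bound on \<open>x\<close>.\<close>

lemma multiple_choose_ge:
  fixes Q x :: real and d m :: nat
  assumes d: "2 \<le> d" and Q: "1 \<le> Q" and m: "2 * Q powr (1 / d) \<le> m" and x: "x \<le> 1 + Q powr (1 - 1 / d)"
  shows "x \<le> ((d - 1) * m) choose (d - 1)"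
proof -
  have Q1: "1 \<le> Q powr a" if "0 \<le> a" for a using Q that by (rule ge_one_powr_ge_zero)
  have "2 \<le> real m" using m Q1[of "1 / d"] by simp
  then have m1: "1 \<le> m" by simp
  have "1 - 1 / real d = 1 / real d * real (d - 1)"
    using d by (simp add: field_simps)
  then have e: "Q powr (1 - 1 / d) = (Q powr (1 / d)) ^ (d - 1)"
    using Q by (simp add: powr_powr flip: powr_realpow)
  have "x \<le> 2 ^ 1 * Q powr (1 - 1 / d)" using x Q1[of "1 - 1 / d"] d by simp
  also have "\<dots> \<le> 2 ^ (d - 1) * Q powr (1 - 1 / d)"
    using d by (intro mult_right_mono power_increasing) auto
  also have "\<dots> = (2 * Q powr (1 / d)) ^ (d - 1)" by (simp add: e power_mult_distrib)
  also have "\<dots> \<le> real m ^ (d - 1)" using m by (intro power_mono) simp_all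
  also have "\<dots> = (real ((d - 1) * m) / real (d - 1)) ^ (d - 1)" using d by simp
  also have "\<dots> \<le> real (((d - 1) * m) choose (d - 1))"
    using m1 by (intro binomial_ge_n_over_k_pow_k) simp_all
  finally show ?thesis .
qed

text \<open>With the unit \<open>u\<close> of the proof, the main term is at least
  \<open>2 * M * u\<close> and the overlaps cost at most \<open>M * u\<close>, thanks to
  \<open>n > k * Q / 2\<close>. What remains is at least \<open>\<kappa> / 2 ^ (d + 3) * u\<close>,
  and \<open>(d + 3) + (d + 2)\<close> gives the exponent \<open>2 * d + 5\<close>.\<close>

lemma degree_bound:
  fixes Q k \<kappa> n :: real and d M :: nat
  assumes d: "2 \<le> d" and Q: "2 \<le> Q" and k: "0 < k" and \<kappa>: "\<kappa> = k / Q ^ (d - 2)"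
    and M: "real M - 1 \<le> \<kappa> / 2 ^ (d + 3)" "\<kappa> / 2 ^ (d + 3) \<le> M" and n: "k * Q / 2 < n"
  shows "\<kappa> / (2 ^ (2 * d + 5) * Q) * n \<le> M * n / ((Q + 1) * 2 ^ d) - M * (real M - 1) * Q ^ (d - 2)"
proof -
  define u where "u = n / (2 ^ (d + 2) * Q)"
  have n0: "0 < n" using n k Q by (smt (verit) divide_pos_pos mult_pos_pos)
  have Q0: "0 < Q ^ (d - 2)" using Q by simp
  have "M * n / ((2 * Q) * 2 ^ d) \<le> M * n / ((Q + 1) * 2 ^ d)"
    using Q n0 by (intro divide_left_mono mult_right_mono mult_pos_pos) auto
  moreover have "M * n / ((2 * Q) * 2 ^ d) = 2 * (M * u)"
    using Q by (simp add: u_def power_add field_simps)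
  ultimately have 1: "2 * (M * u) \<le> M * n / ((Q + 1) * 2 ^ d)" by simp
  have "(real M - 1) * Q ^ (d - 2) \<le> \<kappa> / 2 ^ (d + 3) * Q ^ (d - 2)"
    using M(1) Q0 by (intro mult_right_mono) simp_all
  also have "\<dots> = k / 2 ^ (d + 3)" using Q by (simp add: \<kappa>)
  also have "\<dots> \<le> (2 * n / Q) / 2 ^ (d + 3)"
    using n Q by (intro divide_right_mono) (simp_all add: field_simps)
  also have "\<dots> = u" using Q by (simp add: u_def power_add field_simps)
  finally have "M * ((real M - 1) * Q ^ (d - 2)) \<le> M * u" by (intro mult_left_mono) simp_all
  then have 2: "M * (real M - 1) * Q ^ (d - 2) \<le> M * u" by (simp add: mult.assoc)
  have "\<kappa> / (2 ^ (2 * d + 5) * Q) * n = \<kappa> / 2 ^ (d + 3) * u"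
  proof -
    have "(2::real) ^ (2 * d + 5) = 2 ^ (d + 3) * 2 ^ (d + 2)"
      unfolding power_add[symmetric] by (rule arg_cong[of _ _ "(^) 2"]) simp
    then show ?thesis by (simp add: u_def)
  qed
  also have "\<dots> \<le> M * u" using M(2) n0 Q by (intro mult_right_mono) (simp_all add: u_def)
  finally show ?thesis using 1 2 by linarith
qed

text \<open>By \<open>1 - \<beta> \<le> exp (- \<beta>)\<close>, the power is at most
  \<open>exp (- \<beta> * j)\<close>, hence at most \<open>1 / Q ^ d\<close>.\<close>

lemma decay_bound:
  fixes Q \<beta> :: real
  assumes Q: "1 \<le> Q" and \<beta>: "0 < \<beta>" "\<beta> \<le> 1" and j: "d * ln Q / \<beta> \<le> real j"
  shows "Q ^ d * (1 - \<beta>) ^ j \<le> 1"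
proof -
  have "d * ln Q \<le> \<beta> * j" using j \<beta>(1) by (simp add: pos_divide_le_eq mult.commute)
  have "(1 - \<beta>) ^ j \<le> exp (- \<beta>) ^ j"
    using \<beta> exp_ge_add_one_self[of "- \<beta>"] by (intro power_mono) simp_all
  also have "\<dots> = exp (- (\<beta> * j))" by (simp flip: exp_of_nat_mult add: mult.commute)
  also have "\<dots> \<le> exp (- (d * ln Q))" using \<open>d * ln Q \<le> \<beta> * j\<close> by simp
  also have "\<dots> = inverse (Q ^ d)"
    using Q by (simp add: exp_minus exp_of_nat_mult)
  finally have "Q ^ d * (1 - \<beta>) ^ j \<le> Q ^ d * inverse (Q ^ d)"
    using Q by (intro mult_left_mono) simp_all
  then show ?thesis using Q by simp
qed

text \<open>\<open>X\<close> stands for \<open>q ^ (d - 1) / k\<close>. There are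
  \<open>O(X log q)\<close> choices, each among at most \<open>q ^ (d + 1)\<close> options and so
  worth \<open>(d + 1) log q\<close> bits; this is the source of the squared logarithm.\<close>

lemma count_bound:
  fixes X :: real and q d s j :: nat
  assumes q: "2 \<le> q" and d: "2 \<le> d" and X: "1 \<le> X" and s: "s \<le> 3 * d * X"
    and j: "j \<le> d * ln q * 2 ^ (2 * d + 5) * X + 1"
  shows "real ((q ^ d + 1) ^ (s + j)) \<le>
    2 powr (real (d + 1) * (3 * real d + real d * 2 ^ (2 * d + 5) + 1) * X * (log 2 q)\<^sup>2)"
proof -
  define l where "l = log 2 q"
  have l1: "1 \<le> l" using q by (simp add: l_def le_log_iff)
  have "ln q \<le> l"
  proof -
    have "ln (2::real) \<le> 1" using ln_le_minus_one[of 2] by simp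
    then have "ln q * ln 2 \<le> ln (real q)" using q by (intro mult_right_le_one_le) simp_all
    then show ?thesis by (simp add: l_def log_def pos_le_divide_eq)
  qed
  have Xl: "X \<le> X * l" "1 \<le> X * l" using X l1 mult_mono[of 1 X 1 l] by simp_all
  have sb: "s \<le> 3 * d * (X * l)"
    using s mult_left_mono[OF Xl(1), of "3 * real d"] by simp
  have "d * ln q * 2 ^ (2 * d + 5) * X = d * 2 ^ (2 * d + 5) * (X * ln q)" by simp
  also have "\<dots> \<le> d * 2 ^ (2 * d + 5) * (X * l)"
    using \<open>ln q \<le> l\<close> X by (intro mult_left_mono) simp_all
  finally have jb: "j \<le> d * 2 ^ (2 * d + 5) * (X * l) + X * l" using j Xl(2) by linarith
  have sj: "real (s + j) \<le> (3 * real d + real d * 2 ^ (2 * d + 5) + 1) * (X * l)"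
    using sb jb by (simp add: algebra_simps)
  have "q ^ d + 1 \<le> 2 * q ^ d" using q by simp
  also have "\<dots> \<le> q * q ^ d" using q by (rule mult_le_mono1)
  also have "\<dots> = q ^ (d + 1)" by simp
  finally have "real (q ^ d + 1) \<le> real q ^ (d + 1)" by (metis of_nat_le_iff of_nat_power)
  also have "\<dots> = 2 powr (real (d + 1) * l)"
  proof -
    have "real q = 2 powr l" using q by (simp add: l_def)
    then have "2 powr (real (d + 1) * l) = real q powr real (d + 1)"
      by (simp add: powr_powr mult.commute)
    also have "\<dots> = real q ^ (d + 1)" using q by (intro powr_realpow) simp
    finally show ?thesis ..
  qed
  finally have "real (q ^ d + 1) ^ (s + j) \<le> (2 powr (real (d + 1) * l)) ^ (s + j)"
    by (intro power_mono) simp_all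
  also have "\<dots> = 2 powr (real (d + 1) * l * (s + j))"
    by (simp add: powr_powr flip: powr_realpow)
  also have "\<dots> \<le> 2 powr (real (d + 1) * l * ((3 * real d + real d * 2 ^ (2 * d + 5) + 1) * (X * l)))"
    using sj l1 by (intro powr_mono mult_left_mono) simp_all
  also have "real (d + 1) * l * ((3 * real d + real d * 2 ^ (2 * d + 5) + 1) * (X * l)) =
      real (d + 1) * (3 * real d + real d * 2 ^ (2 * d + 5) + 1) * X * l\<^sup>2"
    by (simp only: power2_eq_square mult_ac)
  finally show ?thesis by (simp add: l_def)
qed

lemma containers_of_size:
  fixes F :: "'a ring" and k :: real
  assumes F: "Ring.field F" "order F = q" and q: "2 \<le> q" and d: "2 \<le> d"
    and k: "4 * real d * real q ^ (d - 2) \<le> k" "k \<le> real q powr (real d - 1 - 1 / real d)"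
  shows "\<exists>\<C>. (\<forall>C\<in>\<C>. C \<subseteq> carrier (affine_space F d)) \<and>
    (\<forall>S. general_position F d S \<longrightarrow> (\<exists>C\<in>\<C>. S \<subseteq> C)) \<and> (\<forall>C\<in>\<C>. card C \<le> k * q) \<and>
    real (card \<C>) \<le> 2 powr (real (d + 1) * (3 * real d + real d * 2 ^ (2 * d + 5) + 1)
      * inverse k * real q ^ (d - 1) * (log 2 q)\<^sup>2)"
proof -
  have card_F: "card (carrier F) = q" using F(2) by (simp add: Coset.order_def)
  have "finite (carrier F)" using card_F q by (intro card_ge_0_finite) simp
  then interpret finite_field F
    using F(1) by (simp add: finite_field_def finite_field_axioms_def)
  define Q where "Q = real q"
  have Q: "2 \<le> Q" using q by (simp add: Q_def)
  have Q1: "1 \<le> Q powr a" if "0 \<le> a" for a using Q that by (intro ge_one_powr_ge_zero) simp_all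
  have "4 * real d * 1 \<le> 4 * real d * Q ^ (d - 2)" using Q by (intro mult_left_mono) simp_all
  then have k4: "4 * real d \<le> k" using k(1) by (simp add: Q_def)
  then have k0: "0 < k" using d by simp
  define \<kappa> where "\<kappa> = k / Q ^ (d - 2)"
  define X where "X = Q ^ (d - 1) / k"
  have \<kappa>: "0 < \<kappa>" "\<kappa> \<le> Q powr (1 - 1 / d)" and X: "Q powr (1 / d) \<le> X"
    using powr_bounds[OF d Q k0] k(2) k0 Q by (simp_all add: \<kappa>_def X_def Q_def)
  have X1: "1 \<le> X" using X Q1[of "1 / d"] by simp
  have \<kappa>Q: "\<kappa> \<le> Q"
    using \<kappa>(2) powr_mono[of "1 - 1 / real d" 1 Q] Q by simp
  define m where "m = nat \<lceil>2 * Q powr (1 / d)\<rceil>"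
  \<comment> \<open>One more than the floor: \<open>M\<close> is at least
    \<open>\<kappa> / 2 ^ (d + 3)\<close>, while \<open>M - 1\<close>, the factor in the overlap
    term, is at most that.\<close>
  define M where "M = 1 + nat \<lfloor>\<kappa> / 2 ^ (d + 3)\<rfloor>"
  \<comment> \<open>The rate delivered by \<open>degree_bound\<close>; \<open>j\<close> steps at
    this rate shrink \<open>q ^ d\<close> to at most 1.\<close>
  define \<beta> where "\<beta> = \<kappa> / (2 ^ (2 * d + 5) * Q)"
  define j where "j = nat \<lceil>d * ln Q / \<beta>\<rceil>"
  have M: "real M - 1 \<le> \<kappa> / 2 ^ (d + 3)" "\<kappa> / 2 ^ (d + 3) \<le> M"
  proof -
    have "0 \<le> \<kappa> / 2 ^ (d + 3)" using \<kappa>(1) by simp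
    then have "real M = 1 + of_int \<lfloor>\<kappa> / 2 ^ (d + 3)\<rfloor>" by (simp add: M_def)
    then show "real M - 1 \<le> \<kappa> / 2 ^ (d + 3)" "\<kappa> / 2 ^ (d + 3) \<le> M" by linarith+
  qed
  have "\<kappa> / 2 ^ (d + 3) \<le> \<kappa> / 1" using \<kappa>(1) by (intro divide_left_mono) simp_all
  then have Mx: "real M \<le> 1 + Q powr (1 - 1 / d)" using M(1) \<kappa>(2) by simp
  have m: "2 * Q powr (1 / d) \<le> m" "m \<le> 2 * Q powr (1 / d) + 1"
  proof -
    have "0 \<le> 2 * Q powr (1 / d)" by simp
    then have "real m = of_int \<lceil>2 * Q powr (1 / d)\<rceil>" unfolding m_def by simp
    then show "2 * Q powr (1 / d) \<le> m" "m \<le> 2 * Q powr (1 / d) + 1" by linarith+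
  qed
  have "1 \<le> Q" using Q by simp
  from multiple_choose_ge[OF d this m(1) Mx] have Ms: "M \<le> ((d - 1) * m) choose (d - 1)"
    by simp
  have \<beta>0: "0 < \<beta>" using \<kappa>(1) Q by (simp add: \<beta>_def)
  have "1 * Q \<le> 2 ^ (2 * d + 5) * Q" using Q by (intro mult_right_mono one_le_power) simp_all
  then have "\<kappa> \<le> 2 ^ (2 * d + 5) * Q" using \<kappa>Q by linarith
  then have \<beta>1: "\<beta> \<le> 1" using Q by (simp add: \<beta>_def)
  have "0 \<le> d * ln Q / \<beta>" using Q \<beta>0 by simp
  then have j: "d * ln Q / \<beta> \<le> j" "j \<le> d * ln Q / \<beta> + 1" unfolding j_def by linarith+
  have deg: "\<beta> * n \<le> real M * n / real ((q + 1) * 2 ^ d) - real (M * (M - 1) * q ^ (d - 2))"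
    if "k * Q / 2 < n" for n :: nat
  proof -
    \<comment> \<open>The truncated subtraction is exact because \<open>M\<close> is
      positive.\<close>
    have "real (M - 1) = real M - 1" by (simp add: M_def)
    then show ?thesis
      using degree_bound[OF d Q k0 \<kappa>_def M that] by (simp add: \<beta>_def Q_def distrib_right add.commute)
  qed
  \<comment> \<open>The lower bound on \<open>k\<close> enters here through
    \<open>4 * d \<le> k\<close>: half of \<open>k * q\<close> is the threshold of the algorithm,
    and the other half has room for the set in general position itself.\<close>
  have B1: "q * d \<le> k * Q / 2"
  proof -
    have "Q * (2 * d) \<le> Q * (k / 2)" using k4 Q by (intro mult_left_mono) simp_all
    then show ?thesis using Q d mult_left_mono[of "real d" "2 * d" Q] by (simp add: Q_def mult_ac)
  qed
  have "1 \<le> k * Q / 2"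
  proof -
    have "1 \<le> q * d" using q d by simp
    then show ?thesis using B1 by linarith
  qed
  then have dec: "real (q ^ d) * (1 - \<beta>) ^ j \<le> k * Q / 2"
    using decay_bound[OF \<open>1 \<le> Q\<close> \<beta>0 \<beta>1 j(1)] by (simp add: Q_def)
  have "0 \<le> k * Q / 2" using k0 Q by simp
  have "k * Q / 2 + real (q * d) \<le> k * q" using B1 by (simp add: Q_def)
  from general_position_containers[OF d Ms \<beta>1 \<open>0 \<le> k * Q / 2\<close>, unfolded card_F, OF deg dec this]
  obtain \<C> where "(\<forall>C\<in>\<C>. C \<subseteq> points d) \<and> (\<forall>S. general_position F d S \<longrightarrow> (\<exists>C\<in>\<C>. S \<subseteq> C)) \<and>
    (\<forall>C\<in>\<C>. card C \<le> k * q) \<and> card \<C> \<le> (q ^ d + 1) ^ ((d - 1) * m + j)"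
    by (rule exE)
  then have C: "\<forall>C\<in>\<C>. C \<subseteq> points d" "\<forall>S. general_position F d S \<longrightarrow> (\<exists>C\<in>\<C>. S \<subseteq> C)"
    "\<forall>C\<in>\<C>. card C \<le> k * q" "card \<C> \<le> (q ^ d + 1) ^ ((d - 1) * m + j)"
    by - (elim conjE, assumption)+
  have "real ((d - 1) * m) \<le> 3 * d * X"
  proof -
    have "m \<le> 3 * X" using m(2) X X1 by linarith
    then have "real (d - 1) * m \<le> d * (3 * X)" by (intro mult_mono) simp_all
    then show ?thesis by simp
  qed
  moreover have "j \<le> d * ln q * 2 ^ (2 * d + 5) * X + 1"
  proof -
    \<comment> \<open>This identifies \<open>1 / \<beta>\<close> with
      \<open>2 ^ (2 * d + 5) * X\<close>, so \<open>j\<close> is of order \<open>X\<close> times a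
      logarithm.\<close>
    have "Q * Q ^ (d - 2) = Q ^ (d - 1)" 
      unfolding power_Suc[symmetric] using d by (intro arg_cong[of _ _ "(^) Q"]) simp
    then have "1 / \<beta> = 2 ^ (2 * d + 5) * X"
      using k0 Q by (simp add: \<beta>_def \<kappa>_def X_def mult.commute)
    moreover have "d * ln Q / \<beta> = d * ln Q * (1 / \<beta>)" by simp
    ultimately show ?thesis using j(2) by (simp add: Q_def mult.assoc)
  qed
  ultimately have "real ((q ^ d + 1) ^ ((d - 1) * m + j)) \<le>
    2 powr (real (d + 1) * (3 * real d + real d * 2 ^ (2 * d + 5) + 1) * X * (log 2 q)\<^sup>2)"
    by (rule count_bound[OF q d X1])
  moreover have "real (card \<C>) \<le> real ((q ^ d + 1) ^ ((d - 1) * m + j))"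
    using C(4) by (simp only: of_nat_le_iff)
  ultimately have "real (card \<C>) \<le> 2 powr (real (d + 1) * (3 * real d + real d * 2 ^ (2 * d + 5) + 1)
      * inverse k * real q ^ (d - 1) * (log 2 q)\<^sup>2)"
    by (simp add: X_def Q_def divide_inverse mult_ac)
  then show ?thesis
    using C(1-3) unfolding carrier_affine_space by (intro exI[of _ \<C>] conjI)
qed

theorem theorem5p3:
  fixes d :: nat
  assumes "d \<ge> 2"
  shows "\<exists>c::real. c > 0 \<and>
    (\<forall>\<^sub>F q :: nat in sequentially. primepow q \<longrightarrow>
      (\<forall>F :: nat ring. Ring.field F \<and> order F = q \<longrightarrow>
        (\<forall>k :: real. 4 * real d * real q ^ (d - 2) \<le> k \<and>
                     k \<le> real q powr (real d - 1 - 1 / real d) \<longrightarrow>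
          (\<exists>\<C> :: (nat \<Rightarrow> nat) set set.
             (\<forall>C \<in> \<C>. C \<subseteq> carrier (affine_space F d)) \<and>
             (\<forall>S. general_position F d S \<longrightarrow> (\<exists>C \<in> \<C>. S \<subseteq> C)) \<and>
             (\<forall>C \<in> \<C>. real (card C) \<le> k * real q) \<and>
             real (card \<C>) \<le>
               2 powr (c * inverse k * real q ^ (d - 1) * (log 2 (real q))\<^sup>2)))))"
proof (intro exI conjI)
  \<comment> \<open>The factor \<open>d + 1\<close> is the cost of a choice. In the other factor,
    \<open>3 * d\<close> accounts for the points of \<open>T\<close>,
    \<open>d * 2 ^ (2 * d + 5)\<close> for the steps of the algorithm and 1 for rounding
    \<open>j\<close> up.\<close>
  let ?c = "real (d + 1) * (3 * real d + real d * 2 ^ (2 * d + 5) + 1)"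
  show "0 < ?c" by (simp add: add_nonneg_pos)
  show "\<forall>\<^sub>F q :: nat in sequentially. primepow q \<longrightarrow>
      (\<forall>F :: nat ring. Ring.field F \<and> order F = q \<longrightarrow>
        (\<forall>k :: real. 4 * real d * real q ^ (d - 2) \<le> k \<and>
                     k \<le> real q powr (real d - 1 - 1 / real d) \<longrightarrow>
          (\<exists>\<C> :: (nat \<Rightarrow> nat) set set.
             (\<forall>C \<in> \<C>. C \<subseteq> carrier (affine_space F d)) \<and>
             (\<forall>S. general_position F d S \<longrightarrow> (\<exists>C \<in> \<C>. S \<subseteq> C)) \<and>
             (\<forall>C \<in> \<C>. real (card C) \<le> k * real q) \<and>
             real (card \<C>) \<le>
               2 powr (?c * inverse k * real q ^ (d - 1) * (log 2 (real q))\<^sup>2))))"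
  \<comment> \<open>All estimates hold from \<open>q = 2\<close> on, where \<open>log 2 q\<close> is
    at least 1.\<close>
  proof (rule eventually_sequentiallyI[of 2], intro impI allI, elim conjE)
    fix q :: nat and F :: "nat ring" and k :: real
    assume "2 \<le> q" "Ring.field F" "order F = q" "4 * real d * real q ^ (d - 2) \<le> k"
      "k \<le> real q powr (real d - 1 - 1 / real d)"
    from containers_of_size[OF this(2,3,1) assms this(4,5)]
    show "\<exists>\<C> :: (nat \<Rightarrow> nat) set set.
             (\<forall>C \<in> \<C>. C \<subseteq> carrier (affine_space F d)) \<and>
             (\<forall>S. general_position F d S \<longrightarrow> (\<exists>C \<in> \<C>. S \<subseteq> C)) \<and>
             (\<forall>C \<in> \<C>. real (card C) \<le> k * real q) \<and>
             real (card \<C>) \<le>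
               2 powr (?c * inverse k * real q ^ (d - 1) * (log 2 (real q))\<^sup>2)" .
  qed
qed

end
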